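(* Let $d>1$ and let $\Gamma\subset GL(d,\mathbb{R})$ be a sub-semigroup which is strongly irreducible and contains a proximal element. Let $\Delta_\Gamma$ be the set of proximal elements of $\Gamma$ and let $S_\Gamma=\{\log|\lambda_g| : g\in\Delta_\Gamma\}$. Then $S_\Gamma$ generates a dense subgroup of $\mathbb{R}$.
   Context: A matrix $\gamma\in GL(d,\mathbb{R})$ is proximal if it has an eigenvalue $\lambda_\gamma$ with $|\lambda_\gamma|>|\lambda|$ for all other (complex) eigenvalues $\lambda$ of $\gamma$, counted with algebraic multiplicity (so $\lambda_\gamma$ is real and simple); for proximal $g$, $\lambda_g$ denotes this dominant eigenvalue. $\Gamma$ is strongly irreducible if there is no finite union $W_1\cup\dots\cup W_n$ ($n\ge 1$) of non-zero proper subspaces of $\mathbb{R}^d$ which is $\Gamma$-invariant (i.e. mapped into itself by every $\gamma\in\Gamma$). *)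

theory Defs
  imports "HOL-Analysis.Analysis" "HOL-Computational_Algebra.Computational_Algebra"
begin

definition sub_semigroup_GL :: "(real^'n^'n) set \<Rightarrow> bool" where
  "sub_semigroup_GL \<Gamma> \<longleftrightarrow>
     (\<forall>g\<in>\<Gamma>. invertible g) \<and> (\<forall>g\<in>\<Gamma>. \<forall>h\<in>\<Gamma>. g ** h \<in> \<Gamma>)"

definition charpoly :: "'a::comm_ring_1^'n^'n \<Rightarrow> 'a poly" where
  "charpoly A = det (mat [:0, 1:] - (\<chi> i j. [:A $ i $ j:]))"

text \<open>The complex eigenvalues of a real matrix, as a multiset: each one occurs with its
  algebraic multiplicity.\<close>

definition eigenvalues :: "real^'n^'n \<Rightarrow> complex multiset" where
  "eigenvalues A = proots (map_poly complex_of_real (charpoly A))"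

text \<open>Only one copy of \<open>\<alpha>\<close> is removed from the multiset, so a dominant
  eigenvalue is simple.\<close>

definition is_dominant_eigenvalue :: "real^'n^'n \<Rightarrow> complex \<Rightarrow> bool" where
  "is_dominant_eigenvalue g \<alpha> \<longleftrightarrow>
     \<alpha> \<in># eigenvalues g \<and> (\<forall>\<mu> \<in># eigenvalues g - {#\<alpha>#}. norm \<mu> < norm \<alpha>)"

definition proximal :: "real^'n^'n \<Rightarrow> bool" where
  "proximal g \<longleftrightarrow> (\<exists>\<alpha>. is_dominant_eigenvalue g \<alpha>)"

lemma dominant_eigenvalue_unique:
  assumes "is_dominant_eigenvalue g \<alpha>" "is_dominant_eigenvalue g \<mu>"
  shows "\<alpha> = \<mu>"
proof (rule ccontr)
  assume "\<alpha> \<noteq> \<mu>"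
  then have "\<mu> \<in># eigenvalues g - {#\<alpha>#}" "\<alpha> \<in># eigenvalues g - {#\<mu>#}"
    using assms by (auto simp: is_dominant_eigenvalue_def in_diff_count)
  then have "norm \<mu> < norm \<alpha>" "norm \<alpha> < norm \<mu>"
    using assms by (auto simp: is_dominant_eigenvalue_def)
  then show False by simp
qed

text \<open>Meaningful for proximal matrices only. The value is in fact real; it is kept as a
  complex number because it is selected among the complex eigenvalues.\<close>

definition dominant_eigenvalue :: "real^'n^'n \<Rightarrow> complex" where
  "dominant_eigenvalue g = (THE \<alpha>. is_dominant_eigenvalue g \<alpha>)"

definition strongly_irreducible :: "(real^'n^'n) set \<Rightarrow> bool" where
  "strongly_irreducible \<Gamma> \<longleftrightarrow>
     \<not> (\<exists>\<W> :: (real^'n) set set.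
          finite \<W> \<and> \<W> \<noteq> {} \<and>
          (\<forall>W\<in>\<W>. subspace W \<and> W \<noteq> {0} \<and> W \<noteq> UNIV) \<and>
          (\<forall>\<gamma>\<in>\<Gamma>. (\<lambda>x. \<gamma> *v x) ` (\<Union>\<W>) \<subseteq> \<Union>\<W>))"

definition proximal_elements :: "(real^'n^'n) set \<Rightarrow> (real^'n^'n) set" where
  "proximal_elements \<Gamma> = {g \<in> \<Gamma>. proximal g}"

definition log_spectrum :: "(real^'n^'n) set \<Rightarrow> real set" where
  "log_spectrum \<Gamma> = (\<lambda>g. ln (norm (dominant_eigenvalue g))) ` proximal_elements \<Gamma>"

end

theory Submission
  imports Defs
begin

text \<open>
  Let \<open>H\<close> be the closure of the group generated by \<open>S\<^sub>\<Gamma>\<close> and suppose that it is not all of the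
  line; then \<open>H\<close> is a discrete group (\<open>additive_subgroup_of_real_dense\<close>). Fix a proximal
  \<open>g \<in> \<Gamma>\<close> with dominant eigenvalue \<open>a\<close>, a right eigenvector \<open>v\<close> and a left eigenvector \<open>f\<close>
  normalised by \<open>f(v) = 1\<close>. The powers \<open>g\<^sup>n / a\<^sup>n\<close> converge to the rank one projection
  \<open>x \<mapsto> f(x) v\<close> (\<open>proximal_powers_tendsto_rank_one\<close>). Hence for \<open>\<gamma> \<in> \<Gamma>\<close> with \<open>f(\<gamma> v) \<noteq> 0\<close> the
  matrices \<open>g\<^sup>n \<gamma>\<close> are eventually proximal, and their dominant eigenvalues divided by \<open>a\<^sup>n\<close> converge
  to the only nonzero eigenvalue \<open>f(\<gamma> v)\<close> of the rank one limit
  (\<open>dominant_eigenvalue_power_mult_tendsto\<close>). As \<open>H\<close> is a closed group, this puts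
  \<open>log |f(\<gamma> v)|\<close> into \<open>H\<close>: every matrix coefficient \<open>f(\<gamma> v)\<close> is zero or has its logarithm in \<open>H\<close>.

  Discreteness now makes a limit exact. If \<open>f(\<gamma> v)\<close> and \<open>f(\<delta> v)\<close> are nonzero, the numbers
  \<open>f(\<gamma> g\<^sup>n \<delta> v) / a\<^sup>n\<close> have logarithms of absolute values in \<open>H\<close> and converge to
  \<open>f(\<gamma> v) f(\<delta> v) \<noteq> 0\<close>, so they are eventually equal to it. In other words, the functional
  \<open>f \<circ> \<gamma>\<close> kills \<open>g\<^sup>n z\<close> for large \<open>n\<close>, where \<open>z = \<delta> v - f(\<delta> v) v\<close>; since \<open>g\<close> is
  invertible, it kills \<open>z\<close> itself (\<open>functional_vanishes_on_orbit\<close>). Thus for every \<open>\<gamma> \<in> \<Gamma>\<close>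
  either \<open>f(\<gamma> v) = 0\<close> or \<open>f(\<gamma> z) = 0\<close>.

  Strong irreducibility forbids such alternatives unless \<open>z = 0\<close>
  (\<open>exists_avoiding_two_hyperplanes\<close>, a consequence of the cover lemma
  \<open>finite_subspace_cover_transitive\<close>). So each \<open>\<delta> v\<close> lies on the line of \<open>v\<close> or in the kernel
  of \<open>f\<close>. In dimension at least two the line of \<open>v\<close> lies in a hyperplane as well, and the same
  lemma gives a contradiction.
\<close>

section \<open>Closed subgroups of the real line\<close>

text \<open>The multiples of an element of absolute value below \<open>e\<close> leave no gap of length \<open>e\<close>.\<close>

lemma additive_subgroup_of_real_dense:
  fixes H :: "real set"
  assumes sub: "\<And>x y. x \<in> H \<Longrightarrow> y \<in> H \<Longrightarrow> x - y \<in> H"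
    and small: "\<And>e. e > 0 \<Longrightarrow> \<exists>x\<in>H. x \<noteq> 0 \<and> \<bar>x\<bar> < e"
  shows "closure H = UNIV"
proof -
  have "H \<noteq> {}" using small[of 1] by auto
  then have z: "0 \<in> H" using sub by (metis all_not_in_conv diff_self)
  have neg: "- x \<in> H" if "x \<in> H" for x using sub[OF z that] by simp
  have add: "x + y \<in> H" if "x \<in> H" "y \<in> H" for x y using sub[OF that(1) neg[OF that(2)]] by simp
  have natmul: "of_nat n * x \<in> H" if "x \<in> H" for n x
    by (induction n) (auto simp: algebra_simps z intro!: add that)
  have intmul: "of_int k * x \<in> H" if "x \<in> H" for k x
    using natmul[OF that, of "nat \<bar>k\<bar>"] neg[OF natmul[OF that, of "nat \<bar>k\<bar>"]] by (cases "k \<ge> 0") auto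
  have "\<exists>y\<in>H. dist y t < e" if e: "e > 0" for t e
  proof -
    obtain x where x: "x \<in> H" "x \<noteq> 0" "\<bar>x\<bar> < e" using small[OF e] by auto
    define h where "h = \<bar>x\<bar>"
    have h: "h > 0" "h < e" using x by (auto simp: h_def)
    have hH: "h \<in> H" using x neg by (auto simp: h_def abs_if)
    have "of_int \<lfloor>t / h\<rfloor> * h \<le> t" "t < (of_int \<lfloor>t / h\<rfloor> + 1) * h"
      using h floor_divide_lower[of h t] floor_divide_upper[of h t] by auto
    then have "dist (of_int \<lfloor>t / h\<rfloor> * h) t < e"
      using h by (auto simp: dist_real_def algebra_simps)
    then show ?thesis using intmul[OF hH] by blast
  qed
  then show ?thesis by (auto simp: closure_approachable)
qed

lemma closure_additive_subgroup_diff: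
  fixes H :: "real set"
  assumes sub: "\<And>x y. x \<in> H \<Longrightarrow> y \<in> H \<Longrightarrow> x - y \<in> H"
    and "x \<in> closure H" "y \<in> closure H"
  shows "x - y \<in> closure H"
proof -
  obtain a b where "\<And>n. a n \<in> H" "a \<longlonglongrightarrow> x" "\<And>n. b n \<in> H" "b \<longlonglongrightarrow> y"
    using assms(2,3) by (auto simp: closure_sequential)
  then have "(\<lambda>n. a n - b n) \<longlonglongrightarrow> x - y" "\<And>n. a n - b n \<in> H"
    by (auto intro: tendsto_diff sub)
  then show ?thesis by (metis closure_sequential)
qed

section \<open>Characteristic polynomials and complex eigenvalues\<close>

lemma poly_det: "poly (det M) z = det (\<chi> i j. poly (M $ i $ j) z)"
  for M :: "'a::comm_ring_1 poly^'n^'n"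
  by (simp add: det_def poly_sum poly_prod)

lemma poly_charpoly: "poly (charpoly A) z = det (mat z - A)"
proof -
  have "(\<chi> i j. poly ((mat [:0, 1:] - (\<chi> i j. [:A $ i $ j:])) $ i $ j) z) = mat z - A"
    by (simp add: vec_eq_iff mat_def)
  then show ?thesis by (simp add: charpoly_def poly_det)
qed

definition complexify :: "real^'n^'m \<Rightarrow> complex^'n^'m" where
  "complexify A = (\<chi> i j. complex_of_real (A $ i $ j))"

definition complex_vec :: "real^'n \<Rightarrow> complex^'n" where
  "complex_vec x = (\<chi> i. complex_of_real (x $ i))"

lemma complexify_nth [simp]: "complexify A $ i $ j = complex_of_real (A $ i $ j)"
  by (simp add: complexify_def)

lemma complex_vec_nth [simp]: "complex_vec x $ i = complex_of_real (x $ i)"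
  by (simp add: complex_vec_def)

lemma complex_vec_eq_0_iff [simp]: "complex_vec x = 0 \<longleftrightarrow> x = 0"
  by (simp add: vec_eq_iff)

lemma complexify_mult_complex_vec: "complexify A *v complex_vec x = complex_vec (A *v x)"
  by (simp add: vec_eq_iff matrix_vector_mult_def)

lemma poly_map_poly_of_real:
  "poly (map_poly complex_of_real p) (of_real x) = of_real (poly p x)"
  by (induction p) (simp_all add: map_poly_pCons)

text \<open>The two polynomials agree at all real points, which are infinitely many.\<close>

lemma charpoly_complexify:
  "map_poly complex_of_real (charpoly A) = charpoly (complexify A)" (is "?p = ?q")
proof -
  have "poly (?p - ?q) (of_real x) = 0" for x
  proof -
    have "poly ?q (of_real x) = det (complexify (mat x - A))"
      by (auto simp: poly_charpoly vec_eq_iff mat_def intro!: arg_cong[where f = det])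
    also have "\<dots> = of_real (det (mat x - A))" by (simp add: det_def)
    finally show ?thesis by (simp add: poly_map_poly_of_real poly_charpoly)
  qed
  then have "range complex_of_real \<subseteq> {z. poly (?p - ?q) z = 0}" by auto
  moreover have "infinite (range complex_of_real)"
    using infinite_UNIV_char_0 by (auto simp: finite_image_iff inj_on_def)
  ultimately have "?p - ?q = 0" using poly_roots_finite finite_subset by blast
  then show ?thesis by simp
qed

lemma eigenvalues_eq: "eigenvalues A = proots (charpoly (complexify A))"
  by (simp add: eigenvalues_def charpoly_complexify)

lemma invertible_mult_vector_eq_0_iff:
  fixes g :: "'a::field^'n^'n"
  assumes "invertible g"
  shows "g *v x = 0 \<longleftrightarrow> x = 0"
  using assms inj_matrix_vector_mult[OF assms] by (metis injD matrix_vector_mult_0_right)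

lemma det_eq_0_iff_kernel:
  fixes A :: "'a::field^'n^'n"
  shows "det A = 0 \<longleftrightarrow> (\<exists>x\<noteq>0. A *v x = 0)"
  by (metis invertible_det_nz invertible_left_inverse matrix_left_invertible_ker)

lemma mat_mult_vec [simp]: "mat z *v x = z *s (x :: 'a::comm_semiring_1^'n)"
proof -
  have "(\<Sum>j\<in>UNIV. (if i = j then z else 0) * x $ j) = z * x $ i" for i
    by (simp add: if_distrib[of "\<lambda>y. y * _"] cong: if_cong)
  then show ?thesis by (simp add: vec_eq_iff matrix_vector_mult_def mat_def)
qed

lemma poly_charpoly_eq_0_iff:
  fixes A :: "'a::field^'n^'n"
  shows "poly (charpoly A) z = 0 \<longleftrightarrow> (\<exists>x\<noteq>0. A *v x = z *s x)"
  by (auto simp: poly_charpoly det_eq_0_iff_kernel matrix_vector_mult_diff_rdistrib)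

text \<open>The two leading coefficients in Vieta's formulas.\<close>

lemma coeff_prod_mset_linear:
  fixes M :: "'a::idom multiset"
  defines "P \<equiv> (\<lambda>M :: 'a multiset. \<Prod>x\<in>#M. [:- x, 1:])"
  shows "degree (P M) = size M" "coeff (P M) (size M) = 1"
    "Suc n = size M \<Longrightarrow> coeff (P M) n = - sum_mset M"
proof -
  have "degree (P M) = size M \<and> coeff (P M) (size M) = 1 \<and>
    (\<forall>n. Suc n = size M \<longrightarrow> coeff (P M) n = - sum_mset M)"
  proof (induction M)
    case empty
    then show ?case by (simp add: P_def)
  next
    case (add x M)
    have eq: "P (add_mset x M) = [:- x, 1:] * P M" by (simp add: P_def)
    have nz: "P M \<noteq> 0" using add.IH by (metis coeff_0 zero_neq_one)
    have deg: "degree (P (add_mset x M)) = size (add_mset x M)"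
      unfolding eq using nz add.IH by (subst degree_mult_eq) auto
    have c: "coeff (P (add_mset x M)) (Suc k) = coeff (P M) k - x * coeff (P M) (Suc k)" for k
      by (simp add: eq)
    have "coeff (P M) (Suc (size M)) = 0" using add.IH by (intro coeff_eq_0) simp
    then have lead: "coeff (P (add_mset x M)) (size (add_mset x M)) = 1" using c add.IH by simp
    have "coeff (P (add_mset x M)) (size M) = - sum_mset (add_mset x M)"
    proof (cases "size M")
      case 0
      then show ?thesis by (simp add: P_def)
    next
      case (Suc k)
      then show ?thesis using c[of k] add.IH by simp
    qed
    then show ?case using deg lead by simp
  qed
  then show "degree (P M) = size M" "coeff (P M) (size M) = 1"
    "Suc n = size M \<Longrightarrow> coeff (P M) n = - sum_mset M" by auto
qed

text \<open>A permutation other than the identity moves at least two indices, so its term in the Leibniz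
  expansion has degree at most \<open>CARD('n) - 2\<close>. The two leading coefficients are those of the product of
  the diagonal entries.\<close>

lemma charpoly_coeffs:
  fixes A :: "'a::idom^'n^'n"
  shows "coeff (charpoly A) CARD('n) = 1" "degree (charpoly A) = CARD('n)"
    "Suc n = CARD('n) \<Longrightarrow> coeff (charpoly A) n = - trace A"
proof -
  define X where "X = mat [:0, 1:] - (\<chi> i j. [:A $ i $ j:])"
  define D where "D = image_mset (\<lambda>i. A $ i $ i) (mset_set (UNIV :: 'n set))"
  define L where "L = (\<Prod>i\<in>UNIV. X $ i $ i)"
  define R where "R = (\<Sum>p\<in>{p. p permutes (UNIV :: 'n set)} - {id}. of_int (sign p) * (\<Prod>i\<in>UNIV. X $ i $ p i))"
  have split: "charpoly A = L + R"
    unfolding charpoly_def det_def X_def[symmetric] R_def L_def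
    by (subst sum.remove[of _ id]) (auto simp: permutes_id sign_id finite_permutations)
  have "L = (\<Prod>x\<in>#D. [:- x, 1:])"
    by (simp add: L_def D_def X_def mat_def prod_unfold_prod_mset image_mset.compositionality o_def)
  moreover have "size D = CARD('n)" "sum_mset D = trace A"
    by (simp_all add: D_def trace_def sum_unfold_sum_mset)
  ultimately have L: "degree L = CARD('n)" "coeff L CARD('n) = 1"
    "\<And>n. Suc n = CARD('n) \<Longrightarrow> coeff L n = - trace A"
    using coeff_prod_mset_linear[where M = D] by auto
  have "coeff R n = 0" if n: "CARD('n) \<le> Suc n" for n
    unfolding R_def coeff_sum
  proof (rule sum.neutral, rule)
    fix p assume "p \<in> {p. p permutes (UNIV :: 'n set)} - {id}"
    then have p: "inj p" "p \<noteq> id" using permutes_inj by auto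
    then obtain i where i: "p i \<noteq> i" by (auto simp: fun_eq_iff)
    then have "p (p i) \<noteq> p i" using p by (simp add: inj_eq)
    then have "{j. p j = j} \<subseteq> UNIV - {i, p i}" using i by auto
    then have "card {j. p j = j} \<le> card (UNIV - {i, p i})" by (intro card_mono) auto
    also have "\<dots> = CARD('n) - 2" using i by (subst card_Diff_subset) auto
    finally have fixed: "card {j. p j = j} \<le> CARD('n) - 2" .
    have "card {i, p i} \<le> CARD('n)" by (intro card_mono) auto
    then have two: "2 \<le> CARD('n)" using i by simp
    have "degree (\<Prod>j\<in>UNIV. X $ j $ p j) \<le> (\<Sum>j\<in>UNIV. degree (X $ j $ p j))"
      using degree_prod_sum_le[of UNIV "\<lambda>j. X $ j $ p j"] by (simp add: o_def)
    also have "\<dots> \<le> (\<Sum>j\<in>UNIV. if p j = j then 1 else 0)"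
      by (intro sum_mono) (auto simp: X_def mat_def)
    also have "\<dots> = card {j. p j = j}" by (simp add: sum.If_cases)
    finally have "degree (\<Prod>j\<in>UNIV. X $ j $ p j) < n" using fixed n two by linarith
    then have "coeff (\<Prod>j\<in>UNIV. X $ j $ p j) n = 0" by (rule coeff_eq_0)
    then show "coeff (of_int (sign p) * (\<Prod>j\<in>UNIV. X $ j $ p j)) n = 0"
      by (cases "sign p = 1") (auto simp: sign_def)
  qed
  note R = this
  show c: "coeff (charpoly A) CARD('n) = 1" using L R by (simp add: split)
  show "Suc n = CARD('n) \<Longrightarrow> coeff (charpoly A) n = - trace A" using L R by (simp add: split)
  have "degree (charpoly A) \<le> CARD('n)"
    by (rule degree_le) (use L R in \<open>simp add: split coeff_eq_0\<close>)
  moreover have "CARD('n) \<le> degree (charpoly A)" using c by (intro le_degree) simp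
  ultimately show "degree (charpoly A) = CARD('n)" by simp
qed

lemma charpoly_nonzero: "charpoly (A :: 'a::idom^'n^'n) \<noteq> 0"
  using charpoly_coeffs(1)[of A] by auto

lemma size_eigenvalues: "size (eigenvalues (A :: real^'n^'n)) = CARD('n)"
  by (simp add: eigenvalues_eq size_proots_complex charpoly_coeffs)

text \<open>Both sides are read off from the second coefficient of the characteristic polynomial.\<close>

lemma sum_eigenvalues: "sum_mset (eigenvalues (A :: real^'n^'n)) = of_real (trace A)"
proof -
  define q where "q = charpoly (complexify A)"
  have q: "lead_coeff q = 1" by (simp add: q_def charpoly_coeffs)
  have "q = (\<Prod>x\<in>#eigenvalues A. [:- x, 1:])"
    using complex_poly_decompose_multiset[of q] q by (simp add: eigenvalues_eq q_def)
  moreover obtain n where n: "Suc n = CARD('n)" using zero_less_card_finite[where 'a='n] gr0_conv_Suc by metis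
  ultimately have "coeff q n = - sum_mset (eigenvalues A)"
    using coeff_prod_mset_linear(3)[where n = n and M = "eigenvalues A"] size_eigenvalues[of A] by simp
  moreover have "coeff q n = - trace (complexify A)" unfolding q_def using n by (rule charpoly_coeffs)
  ultimately show ?thesis by (simp add: trace_def)
qed

lemma in_eigenvalues_iff:
  "z \<in># eigenvalues A \<longleftrightarrow> (\<exists>w\<noteq>0. complexify A *v w = z *s w)"
  by (simp add: eigenvalues_eq charpoly_nonzero poly_charpoly_eq_0_iff)

lemma cnj_eigenvalue:
  assumes "z \<in># eigenvalues A" shows "cnj z \<in># eigenvalues A"
proof -
  obtain w where w: "w \<noteq> 0" "complexify A *v w = z *s w" using assms in_eigenvalues_iff by blast
  define w' where "w' = (\<chi> i. cnj (w $ i))"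
  have "w' \<noteq> 0" using w by (simp add: w'_def vec_eq_iff)
  moreover have "complexify A *v w' = cnj z *s w'"
  proof (simp add: vec_eq_iff, intro allI)
    fix i
    have "(complexify A *v w') $ i = cnj ((complexify A *v w) $ i)"
      by (simp add: matrix_vector_mult_def w'_def)
    also have "\<dots> = cnj z * w' $ i" by (simp add: w w'_def)
    finally show "(complexify A *v w') $ i = cnj z * w' $ i" .
  qed
  ultimately show ?thesis using in_eigenvalues_iff by blast
qed

section \<open>Finite covers of a strongly irreducible semigroup by subspaces\<close>

lemma linear_matrix_mult_left: "linear (\<lambda>M. (g :: real^'n^'n) ** M)"
  by (rule linearI) (simp_all add: matrix_add_ldistrib matrix_scalar_ac scalar_matrix_assoc)

lemma linear_matrix_vector_eval: "linear (\<lambda>M :: real^'n^'n. M *v u)"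
  by (rule linearI) (simp_all add: matrix_vector_mult_add_rdistrib scaleR_matrix_vector_assoc)

text \<open>Among the finite covers of \<open>\<Gamma>\<close> by linear spaces of matrices, choose one whose maximal dimension
  \<open>m\<close> is least and which, given \<open>m\<close>, has the fewest members of dimension \<open>m\<close>. Intersecting it
  with any other cover gives a cover again, and minimality forces every \<open>m\<close>-dimensional member
  into a member of the other cover. Comparing with the preimages of the cover under left
  multiplication by \<open>g \<in> \<Gamma>\<close>, one sees that \<open>\<Gamma>\<close> permutes the \<open>m\<close>-dimensional members \<open>V\<close>, so it
  permutes the spaces \<open>V u = {M u | M \<in> V}\<close>. The proper ones among these would contradict strong
  irreducibility, hence \<open>V u\<close> is always the whole space; comparing with the given cover
  transfers this to one of its members.\<close>

lemma finite_subspace_cover_transitive: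
  fixes \<Gamma> :: "(real^'n^'n) set"
  assumes semi: "sub_semigroup_GL \<Gamma>" and irr: "strongly_irreducible \<Gamma>" and ne: "\<Gamma> \<noteq> {}"
    and fin: "finite \<G>" and subsp: "\<And>V. V \<in> \<G> \<Longrightarrow> subspace V" and cov: "\<Gamma> \<subseteq> \<Union>\<G>"
  shows "\<exists>V\<in>\<G>. \<forall>u\<noteq>0. (\<lambda>M. M *v u) ` V = UNIV"
proof -
  define cover where "cover \<F> \<longleftrightarrow> finite \<F> \<and> (\<forall>V\<in>\<F>. subspace V) \<and> \<Gamma> \<subseteq> \<Union>\<F>" for \<F> :: "(real^'n^'n) set set"
  define cov_dim where "cov_dim m \<F> \<longleftrightarrow> cover \<F> \<and> (\<forall>V\<in>\<F>. dim V \<le> m)" for m :: nat and \<F> :: "(real^'n^'n) set set"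
  define top_part where "top_part m \<F> = {V\<in>\<F>. dim V = m}" for m :: nat and \<F> :: "(real^'n^'n) set set"
  have inv: "invertible g" if "g \<in> \<Gamma>" for g using semi that by (auto simp: sub_semigroup_GL_def)
  have mul: "g ** h \<in> \<Gamma>" if "g \<in> \<Gamma>" "h \<in> \<Gamma>" for g h
    using semi that by (auto simp: sub_semigroup_GL_def)
  have G: "cover \<G>" using fin subsp cov by (auto simp: cover_def)
  then have "cov_dim DIM(real^'n^'n) \<G>" using dim_subset_UNIV unfolding cov_dim_def by blast
  define m where "m = (LEAST m. \<exists>\<F>. cov_dim m \<F>)"
  have m_ex: "\<exists>\<F>. cov_dim m \<F>"
    unfolding m_def by (rule LeastI_ex) (use \<open>cov_dim DIM(real^'n^'n) \<G>\<close> in blast)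
  have m_le: "m \<le> k" if "cov_dim k \<F>" for k \<F> unfolding m_def using that by (auto intro: Least_le)
  obtain \<F>\<^sub>0 where F0: "cov_dim m \<F>\<^sub>0" using m_ex by blast
  obtain \<F> where F: "cov_dim m \<F>"
    and F_min: "\<And>\<F>'. cov_dim m \<F>' \<Longrightarrow> card (top_part m \<F>) \<le> card (top_part m \<F>')"
    using ex_has_least_nat[of "cov_dim m", OF F0, of "\<lambda>\<F>. card (top_part m \<F>)"] by blast
  define T where "T = top_part m \<F>"
  have F_cover: "cover \<F>" and F_dim: "\<And>V. V \<in> \<F> \<Longrightarrow> dim V \<le> m"
    using F by (auto simp: cov_dim_def)
  have finF: "finite \<F>" and subF: "\<And>V. V \<in> \<F> \<Longrightarrow> subspace V" and covF: "\<Gamma> \<subseteq> \<Union>\<F>"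
    using F_cover by (auto simp: cover_def)
  have T_F: "V \<in> \<F>" "dim V = m" if "V \<in> T" for V using that by (auto simp: T_def top_part_def)
  have finT: "finite T" using finF by (auto simp: T_def top_part_def)
  have T_ne: "T \<noteq> {}"
  proof
    assume "T = {}"
    then have less: "dim V < m" if "V \<in> \<F>" for V
      using that F_dim[OF that] by (auto simp: T_def top_part_def)
    obtain V where "V \<in> \<F>" using covF ne by auto
    then have "m > 0" using less by fastforce
    have "cov_dim (m - 1) \<F>" using F_cover less by (fastforce simp: cov_dim_def)
    then show False using m_le[of "m - 1"] \<open>m > 0\<close> by fastforce
  qed
  have refine: "\<exists>W\<in>\<W>. V \<subseteq> W" if W: "cover \<W>" and V: "V \<in> T" for \<W> V
  proof -
    define \<N> where "\<N> = (\<lambda>(V, W). V \<inter> W) ` (\<F> \<times> \<W>)"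
    have "cover \<N>"
      unfolding cover_def
    proof (intro conjI ballI subsetI)
      show "finite \<N>" using finF W by (simp add: \<N>_def cover_def)
      show "subspace X" if "X \<in> \<N>" for X
        using that subF W by (auto simp: \<N>_def cover_def intro!: subspace_inter)
      show "h \<in> \<Union>\<N>" if "h \<in> \<Gamma>" for h
      proof -
        obtain V' W' where "V' \<in> \<F>" "h \<in> V'" "W' \<in> \<W>" "h \<in> W'"
          using \<open>h \<in> \<Gamma>\<close> covF W unfolding cover_def by blast
        then show ?thesis unfolding \<N>_def by blast
      qed
    qed
    moreover have "dim (V \<inter> W) \<le> m" if "V \<in> \<F>" for V W
      using F_dim[OF that] dim_subset[of "V \<inter> W" V] by force
    ultimately have N: "cov_dim m \<N>" by (auto simp: cov_dim_def \<N>_def)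
    have sub: "top_part m \<N> \<subseteq> {V\<in>T. \<exists>W\<in>\<W>. V \<subseteq> W}"
    proof
      fix X assume "X \<in> top_part m \<N>"
      then obtain V W where X: "X = V \<inter> W" "V \<in> \<F>" "W \<in> \<W>" "dim X = m"
        by (auto simp: top_part_def \<N>_def)
      have "dim V = m" using dim_subset[of X V] F_dim[OF X(2)] X by simp
      have "subspace X" using X subF[OF X(2)] W by (auto simp: cover_def intro: subspace_inter)
      then have "X = V"
        using subspace_dim_equal[of X V] subF[OF X(2)] X \<open>dim V = m\<close> by auto
      then show "X \<in> {V\<in>T. \<exists>W\<in>\<W>. V \<subseteq> W}"
        using X \<open>dim V = m\<close> by (auto simp: T_def top_part_def)
    qed
    have "card T \<le> card (top_part m \<N>)" using F_min[OF N] by (simp add: T_def)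
    also have "\<dots> \<le> card {V\<in>T. \<exists>W\<in>\<W>. V \<subseteq> W}"
      using sub finT by (intro card_mono) auto
    finally have "{V\<in>T. \<exists>W\<in>\<W>. V \<subseteq> W} = T"
      using finT by (intro card_seteq) auto
    then show ?thesis using V by blast
  qed
  have T_meets: "V \<inter> \<Gamma> \<noteq> {}" if V: "V \<in> T" for V
  proof
    assume "V \<inter> \<Gamma> = {}"
    \<comment> \<open>Without \<open>V\<close> the family would still cover, so \<open>V\<close> would lie in a different member.\<close>
    then have "cover (\<F> - {V})" using finF subF covF by (fastforce simp: cover_def)
    from refine[OF this V] obtain W where W: "W \<in> \<F>" "W \<noteq> V" "V \<subseteq> W" by auto
    have "V = W"
      using subspace_dim_equal[of V W] subF T_F[OF V] W F_dim[OF W(1)] by auto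
    then show False using W by simp
  qed
  have T_perm: "(\<lambda>M. g ** M) ` V \<in> T" if g: "g \<in> \<Gamma>" and V: "V \<in> T" for g V
  proof -
    have "cover ((\<lambda>W. (\<lambda>M. g ** M) -` W) ` \<F>)"
      unfolding cover_def
    proof (intro conjI ballI subsetI)
      fix W assume "W \<in> (\<lambda>W. (\<lambda>M. g ** M) -` W) ` \<F>"
      then show "subspace W"
        using linear_subspace_vimage[OF linear_matrix_mult_left subF] by auto
    next
      fix h assume "h \<in> \<Gamma>"
      then have "g ** h \<in> \<Union>\<F>" using covF mul[OF g] by blast
      then show "h \<in> \<Union>((\<lambda>W. (\<lambda>M. g ** M) -` W) ` \<F>)" by auto
    qed (use finF in simp)
    from refine[OF this V] obtain W where W: "W \<in> \<F>" "(\<lambda>M. g ** M) ` V \<subseteq> W" by auto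
    have inj: "inj (\<lambda>M. g ** M)"
      using inv[OF g] by (metis injI invertible_def matrix_mul_assoc matrix_mul_lid)
    have "dim ((\<lambda>M. g ** M) ` V) = m"
      using dim_image_eq[OF linear_matrix_mult_left inj_on_subset[OF inj subset_UNIV]] T_F[OF V] by auto
    moreover have "subspace ((\<lambda>M. g ** M) ` V)"
      by (intro linear_subspace_image linear_matrix_mult_left subF T_F[OF V])
    ultimately have "(\<lambda>M. g ** M) ` V = W"
      using subspace_dim_equal[of _ W] W subF[OF W(1)] F_dim[OF W(1)] by metis
    then show ?thesis using W \<open>dim ((\<lambda>M. g ** M) ` V) = m\<close> by (auto simp: T_def top_part_def)
  qed
  have trans: "(\<lambda>M. M *v u) ` V = UNIV" if u: "u \<noteq> 0" and V: "V \<in> T" for u V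
  proof (rule ccontr)
    assume V_ne: "(\<lambda>M. M *v u) ` V \<noteq> UNIV"
    define \<W> where "\<W> = {W. W \<noteq> UNIV \<and> (\<exists>V\<in>T. W = (\<lambda>M. M *v u) ` V)}"
    have "finite \<W>" using finT by (auto simp: \<W>_def)
    moreover have "\<W> \<noteq> {}" using V V_ne by (auto simp: \<W>_def)
    moreover have "subspace W \<and> W \<noteq> {0} \<and> W \<noteq> UNIV" if W: "W \<in> \<W>" for W
    proof -
      obtain V where V: "V \<in> T" "W = (\<lambda>M. M *v u) ` V" "W \<noteq> UNIV"
        using W unfolding \<W>_def by blast
      obtain g where g: "g \<in> V" "g \<in> \<Gamma>" using T_meets[OF V(1)] by auto
      have "g *v u \<in> W" "g *v u \<noteq> 0"
        using V g u inv invertible_mult_vector_eq_0_iff by auto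
      moreover have "subspace W"
        unfolding V(2) by (intro linear_subspace_image linear_matrix_vector_eval subF T_F V(1))
      ultimately show ?thesis using V by auto
    qed
    moreover have "g *v x \<in> \<Union>\<W>" if g: "g \<in> \<Gamma>" and x: "x \<in> \<Union>\<W>" for g x
    proof -
      obtain V where V: "V \<in> T" "x \<in> (\<lambda>M. M *v u) ` V" "(\<lambda>M. M *v u) ` V \<noteq> UNIV"
        using x unfolding \<W>_def by blast
      define V' where "V' = (\<lambda>M. g ** M) ` V"
      have eq: "(\<lambda>M. M *v u) ` V' = (*v) g ` ((\<lambda>M. M *v u) ` V)"
        by (auto simp: V'_def image_image matrix_vector_mul_assoc)
      have "inj ((*v) g)" by (rule inj_matrix_vector_mult[OF inv[OF g]])
      then have "(*v) g ` ((\<lambda>M. M *v u) ` V) \<noteq> UNIV"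
        using V(3) by (metis (no_types, lifting) UNIV_I UNIV_eq_I inj_image_mem_iff)
      then have "(\<lambda>M. M *v u) ` V' \<noteq> UNIV" unfolding eq .
      then have "(\<lambda>M. M *v u) ` V' \<in> \<W>"
        using T_perm[OF g V(1)] unfolding \<W>_def V'_def by blast
      moreover have "g *v x \<in> (\<lambda>M. M *v u) ` V'" unfolding eq using V(2) by (rule imageI)
      ultimately show ?thesis by blast
    qed
    ultimately have "finite \<W> \<and> \<W> \<noteq> {} \<and> (\<forall>W\<in>\<W>. subspace W \<and> W \<noteq> {0} \<and> W \<noteq> UNIV) \<and>
        (\<forall>\<gamma>\<in>\<Gamma>. (\<lambda>x. \<gamma> *v x) ` \<Union>\<W> \<subseteq> \<Union>\<W>)"
      by (intro conjI ballI image_subsetI) simp_all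
    then show False using irr unfolding strongly_irreducible_def by metis
  qed
  obtain V where V: "V \<in> T" using T_ne by auto
  obtain W where W: "W \<in> \<G>" "V \<subseteq> W" using refine[OF G V] by auto
  have "(\<lambda>M. M *v u) ` W = UNIV" if "u \<noteq> 0" for u
    using trans[OF that V] image_mono[OF W(2), of "\<lambda>M. M *v u"] by auto
  then show ?thesis using W by blast
qed

text \<open>Otherwise the two hyperplanes \<open>{M. f\<^sub>i (M u\<^sub>i) = 0}\<close> of the matrix space cover \<open>\<Gamma>\<close>, but neither
  of them maps \<open>u\<^sub>i\<close> onto the whole space.\<close>

lemma exists_avoiding_two_hyperplanes:
  fixes \<Gamma> :: "(real^'n^'n) set"
  assumes "sub_semigroup_GL \<Gamma>" and "strongly_irreducible \<Gamma>" and "\<Gamma> \<noteq> {}"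
    and "f\<^sub>1 \<noteq> 0" "u\<^sub>1 \<noteq> 0" "f\<^sub>2 \<noteq> 0" "u\<^sub>2 \<noteq> 0"
  obtains g where "g \<in> \<Gamma>" "f\<^sub>1 \<bullet> (g *v u\<^sub>1) \<noteq> 0" "f\<^sub>2 \<bullet> (g *v u\<^sub>2) \<noteq> 0"
proof (rule ccontr)
  assume no: "\<not> thesis"
  define P where "P f u = {M :: real^'n^'n. f \<bullet> (M *v u) = 0}" for f u
  have sub: "subspace (P f u)" for f u
    unfolding P_def subspace_def
    using linear_add[OF linear_matrix_vector_eval[of u]] linear_scale[OF linear_matrix_vector_eval[of u]]
    by (auto simp: inner_right_distrib)
  have cov: "\<Gamma> \<subseteq> \<Union>{P f\<^sub>1 u\<^sub>1, P f\<^sub>2 u\<^sub>2}"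
  proof
    fix g assume "g \<in> \<Gamma>"
    with no that[of g] show "g \<in> \<Union>{P f\<^sub>1 u\<^sub>1, P f\<^sub>2 u\<^sub>2}" unfolding P_def by blast
  qed
  have "finite {P f\<^sub>1 u\<^sub>1, P f\<^sub>2 u\<^sub>2}" by simp
  moreover have "subspace V" if "V \<in> {P f\<^sub>1 u\<^sub>1, P f\<^sub>2 u\<^sub>2}" for V
    using that sub[of f\<^sub>1 u\<^sub>1] sub[of f\<^sub>2 u\<^sub>2] by (elim insertE) simp_all
  ultimately obtain V where V: "V \<in> {P f\<^sub>1 u\<^sub>1, P f\<^sub>2 u\<^sub>2}" "\<forall>u\<noteq>0. (\<lambda>M. M *v u) ` V = UNIV"
    using finite_subspace_cover_transitive[OF assms(1,2,3) _ _ cov] by metis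
  then obtain f u where fu: "V = P f u" "f \<noteq> 0" "u \<noteq> 0" using assms(4-7) by (elim insertE) auto
  then have "f \<in> (\<lambda>M. M *v u) ` P f u" using V(2) by simp
  then have "f \<bullet> f = 0" by (auto simp: P_def)
  then show False using fu by simp
qed

section \<open>Powers of a matrix with a simple dominant eigenvalue\<close>

lemma det_const_poly: "det (\<chi> i j. [:B $ i $ j:]) = [:det (B :: complex^'n^'n):]"
  by (rule poly_eq_poly_eq_iff[THEN iffD1]) (simp add: fun_eq_iff poly_det)

text \<open>A second eigenvector (\<open>c = 0\<close>) or a Jordan chain of length two (\<open>c \<noteq> 0\<close>) makes \<open>a\<close> a multiple
  root. Complete \<open>w\<close> and \<open>u\<close> to a basis: after multiplication by its invertible matrix,
  \<open>X - G\<close> has one row divisible by \<open>X - a\<close> and another one that becomes divisible by it after a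
  row operation. Rows occur instead of columns because the determinant rules used are those for
  rows; the matrices are transposed accordingly.\<close>

lemma double_root_of_charpoly:
  fixes G :: "complex^'n^'n"
  assumes w: "G *v w = a *s w" "w \<noteq> 0" and u: "G *v u = a *s u + c *s w"
    and indep: "\<And>k. u \<noteq> k *s w"
  shows "[:- a, 1:]\<^sup>2 dvd charpoly G"
proof -
  obtain i where i: "w $ i \<noteq> 0" using w(2) by (auto simp: vec_eq_iff)
  \<comment> \<open>Clearing one coordinate of \<open>u\<close> makes \<open>w\<close>, \<open>u'\<close> and the unit vectors other than the \<open>i\<close>-th and
  \<open>j\<close>-th a basis; these are the rows of \<open>B\<close> below.\<close>
  define u' where "u' = u - (u $ i / w $ i) *s w"
  have u'i: "u' $ i = 0" using i by (simp add: u'_def)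
  have "u' \<noteq> 0" using indep[of "u $ i / w $ i"] by (simp add: u'_def)
  then obtain j where j: "u' $ j \<noteq> 0" by (auto simp: vec_eq_iff)
  then have ij: "i \<noteq> j" using u'i by auto
  have Gu': "G *v u' = a *s u' + c *s w"
    by (simp add: u'_def matrix_vector_mult_diff_distrib vector_scalar_commute u w(1) vec_eq_iff algebra_simps)
  define B where "B = (\<chi> k. if k = i then w else if k = j then u' else axis k 1)"
  have "x = 0" if Bx: "B *v x = 0" for x
  proof -
    have sum_B: "(\<Sum>l\<in>UNIV. B $ k $ l * x $ l) = 0" for k
      using Bx by (simp add: vec_eq_iff matrix_vector_mult_def)
    have other: "x $ k = 0" if "k \<noteq> i" "k \<noteq> j" for k
      using sum_B[of k] that by (simp add: B_def axis_def if_distrib[of "\<lambda>y. y * _"] cong: if_cong)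
    have two: "(\<Sum>l\<in>UNIV. y $ l * x $ l) = y $ i * x $ i + y $ j * x $ j" for y
    proof -
      have "(\<Sum>l\<in>UNIV. y $ l * x $ l) = (\<Sum>l\<in>{i, j}. y $ l * x $ l)"
        by (rule sum.mono_neutral_right) (auto simp: other)
      then show ?thesis using ij by simp
    qed
    have "x $ j = 0" using sum_B[of j] ij two[of u'] u'i j by (simp add: B_def)
    moreover have "x $ i = 0" using sum_B[of i] two[of w] i calculation by (simp add: B_def)
    ultimately show "x = 0" using other by (metis vec_eq_iff zero_index)
  qed
  then have "det B \<noteq> 0" by (auto simp: det_eq_0_iff_kernel)
  define X where "X = mat [:0, 1:] - (\<chi> i j. [:G $ i $ j:])"
  define Bp where "Bp = (\<chi> k l. [:B $ k $ l:])"
  define cv where "cv y = (\<chi> l. [:y $ l:])" for y :: "complex^'n"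
  define R where "R = Bp ** transpose X"
  have row_R: "R $ k = (\<chi> l. [:0, 1:] * [:B $ k $ l:] - [:(G *v (B $ k)) $ l:])" for k
  proof -
    have "R $ k $ l = [:0, 1:] * [:B $ k $ l:] - [:(G *v (B $ k)) $ l:]" for l
    proof -
      have "R $ k $ l = (\<Sum>m\<in>UNIV. [:B $ k $ m:] * (if l = m then [:0, 1:] else 0))
           - (\<Sum>m\<in>UNIV. [:B $ k $ m:] * [:G $ l $ m:])"
        by (simp add: R_def Bp_def X_def matrix_matrix_mult_def transpose_def mat_def
            right_diff_distrib sum_subtractf)
      also have "(\<Sum>m\<in>UNIV. [:B $ k $ m:] * (if l = m then [:0, 1:] else 0)) = [:0, 1:] * [:B $ k $ l:]"
        by (simp add: if_distrib[of "\<lambda>y. _ * y"] cong: if_cong)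
      also have "(\<Sum>m\<in>UNIV. [:B $ k $ m:] * [:G $ l $ m:]) = [:(G *v (B $ k)) $ l:]"
        by (rule poly_eq_poly_eq_iff[THEN iffD1])
           (simp add: fun_eq_iff poly_sum matrix_vector_mult_def mult.commute)
      finally show ?thesis .
    qed
    then show ?thesis by (simp add: vec_eq_iff)
  qed
  have row_i: "R $ i = [:- a, 1:] *s cv w"
    unfolding row_R by (simp add: B_def cv_def vec_eq_iff w(1))
  have row_j: "R $ j = [:- a, 1:] *s cv u' + [:- c:] *s cv w"
    unfolding row_R using ij by (simp add: B_def cv_def vec_eq_iff Gu')
  define R1 where "R1 = (\<chi> k. if k = i then cv w else R $ k)"
  have R1: "det R = [:- a, 1:] * det R1"
  proof -
    have "R = (\<chi> k. if k = i then [:- a, 1:] *s cv w else R $ k)"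
      by (rule vec_eq_iff[THEN iffD2]) (simp add: row_i)
    then show ?thesis using det_row_mul[of i "[:- a, 1:]" "\<lambda>_. cv w" "\<lambda>k. R $ k"] by (simp add: R1_def)
  qed
  define R2 where "R2 = (\<chi> k. if k = j then cv u' else R1 $ k)"
  have R2: "det R1 = [:- a, 1:] * det R2"
  proof -
    have "(\<chi> k. if k = j then row j R1 + [:c:] *s row i R1 else row k R1)
        = (\<chi> k. if k = j then [:- a, 1:] *s cv u' else R1 $ k)"
      using ij by (auto simp: vec_eq_iff row_def R1_def row_j algebra_simps)
    then have "det R1 = det (\<chi> k. if k = j then [:- a, 1:] *s cv u' else R1 $ k)"
      using det_row_operation[of j i R1 "[:c:]"] ij by simp
    then show ?thesis using det_row_mul[of j "[:- a, 1:]" "\<lambda>_. cv u'" "\<lambda>k. R1 $ k"] by (simp add: R2_def)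
  qed
  have "det R = [:det B:] * charpoly G"
    by (simp add: R_def det_mul Bp_def det_const_poly charpoly_def X_def)
  then have "[:det B:] * charpoly G = [:- a, 1:]\<^sup>2 * det R2"
    by (simp only: R1 R2 power2_eq_square mult.assoc)
  then have "[:- a, 1:]\<^sup>2 dvd [:det B:] * charpoly G" by (metis dvd_triv_left)
  then show ?thesis using \<open>det B \<noteq> 0\<close> by (simp add: dvd_smult_iff)
qed

lemma contraction_recursion_tendsto_0:
  fixes x b :: "nat \<Rightarrow> 'a::real_normed_field"
  assumes rec: "\<And>n. x (Suc n) = r * x n + b n" and r: "norm r < 1" and b: "b \<longlonglongrightarrow> 0"
  shows "x \<longlonglongrightarrow> 0"
proof (rule LIMSEQ_I)
  fix e :: real assume e: "e > 0"
  define q where "q = norm r"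
  have q: "0 \<le> q" "q < 1" using r by (auto simp: q_def)
  define d where "d = e / 2 * (1 - q)"
  have d: "d > 0" using e q by (simp add: d_def)
  obtain N where N: "\<And>n. n \<ge> N \<Longrightarrow> norm (b n) < d" using LIMSEQ_D[OF b d] by auto
  have bound: "norm (x (N + k)) \<le> q ^ k * norm (x N) + e / 2" for k
  proof (induction k)
    case 0
    then show ?case using e by simp
  next
    case (Suc k)
    have "norm (x (N + Suc k)) \<le> q * norm (x (N + k)) + norm (b (N + k))"
      using norm_triangle_ineq[of "r * x (N + k)" "b (N + k)"] by (simp add: rec norm_mult q_def)
    also have "\<dots> \<le> q * (q ^ k * norm (x N) + e / 2) + d"
      using Suc.IH N[of "N + k"] q by (intro add_mono mult_left_mono) auto
    also have "\<dots> = q ^ Suc k * norm (x N) + e / 2" by (simp add: d_def field_simps)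
    finally show ?case .
  qed
  have "(\<lambda>k. q ^ k * norm (x N)) \<longlonglongrightarrow> 0"
    using q by (intro tendsto_mult_left_zero LIMSEQ_power_zero) auto
  then obtain K where K: "\<And>k. k \<ge> K \<Longrightarrow> q ^ k * norm (x N) < e / 2"
    using LIMSEQ_D[of _ 0 "e / 2"] e q by (fastforce simp: abs_mult)
  have "norm (x n) < e" if "n \<ge> N + K" for n
  proof -
    have "n = N + (n - N)" "K \<le> n - N" using that by auto
    then show ?thesis using bound[of "n - N"] K[of "n - N"] by simp
  qed
  then show "\<exists>no. \<forall>n\<ge>no. norm (x n - 0) < e" by auto
qed

text \<open>The vector \<open>p(G) z\<close>. It is formed without the matrix \<open>p(G)\<close>, because the multiplication of the
  type of square matrices as a ring is the entrywise one.\<close>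

definition poly_act :: "complex^'n^'n \<Rightarrow> complex poly \<Rightarrow> complex^'n \<Rightarrow> complex^'n" where
  "poly_act G p z = (\<Sum>i\<le>degree p. coeff p i *s ((*v) G ^^ i) z)"

lemma poly_act_eq_sum:
  assumes "degree p \<le> N"
  shows "poly_act G p z = (\<Sum>i\<le>N. coeff p i *s ((*v) G ^^ i) z)"
  unfolding poly_act_def using assms
  by (intro sum.mono_neutral_left) (auto simp: coeff_eq_0)

lemma funpow_matrix_diff:
  fixes G :: "'a::comm_ring_1^'n^'n"
  shows "((*v) G ^^ i) (x - y) = ((*v) G ^^ i) x - ((*v) G ^^ i) y"
  by (induction i) (simp_all add: matrix_vector_mult_diff_distrib)

lemma funpow_matrix_smult:
  fixes G :: "'a::field^'n^'n"
  shows "((*v) G ^^ i) (c *s x) = c *s ((*v) G ^^ i) x"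
  by (induction i) (simp_all add: vector_scalar_commute)

lemma matrix_vector_sum: "G *v sum f S = (\<Sum>i\<in>S. G *v f i)"
  by (induction S rule: infinite_finite_induct) (simp_all add: matrix_vector_right_distrib)

lemma poly_act_commute: "poly_act G p (G *v z) = G *v poly_act G p z"
  by (simp add: poly_act_def matrix_vector_sum vector_scalar_commute funpow_swap1)

lemma poly_act_diff: "poly_act G p (x - y) = poly_act G p x - poly_act G p y"
  by (simp add: poly_act_def funpow_matrix_diff vector_ssub_ldistrib sum_subtractf)

lemma poly_act_smult: "poly_act G p (c *s x) = c *s poly_act G p x"
  by (simp add: poly_act_def funpow_matrix_smult vec_eq_iff sum_distrib_left mult_ac)

lemma poly_act_linear_factor:
  "poly_act G ([:- \<mu>, 1:] * q) z = poly_act G q (G *v z - \<mu> *s z)"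
proof -
  define N where "N = degree q"
  have "degree ([:- \<mu>, 1:] * q) \<le> Suc N"
    using degree_mult_le[of "[:- \<mu>, 1:]" q] by (simp add: N_def)
  then have "poly_act G ([:- \<mu>, 1:] * q) z
      = (\<Sum>i\<le>Suc N. coeff ([:- \<mu>, 1:] * q) i *s ((*v) G ^^ i) z)" by (rule poly_act_eq_sum)
  also have "\<dots> = (\<Sum>i\<le>Suc N. coeff (pCons 0 q) i *s ((*v) G ^^ i) z)
      - (\<Sum>i\<le>Suc N. \<mu> *s (coeff q i *s ((*v) G ^^ i) z))"
    by (simp add: vector_sub_rdistrib sum_subtractf vec_eq_iff algebra_simps)
  also have "(\<Sum>i\<le>Suc N. coeff (pCons 0 q) i *s ((*v) G ^^ i) z) = poly_act G q (G *v z)"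
    by (simp add: sum.atMost_Suc_shift poly_act_def N_def funpow_swap1 del: sum.atMost_Suc)
  also have "(\<Sum>i\<le>Suc N. \<mu> *s (coeff q i *s ((*v) G ^^ i) z)) = poly_act G q (\<mu> *s z)"
    unfolding poly_act_smult poly_act_eq_sum[of q "Suc N", OF le_SucI[OF eq_refl[OF N_def[symmetric]]]]
    by (simp add: vec_eq_iff sum_distrib_left mult.assoc)
  finally show ?thesis by (simp add: poly_act_diff)
qed

text \<open>Real coefficients suffice: the iterates of \<open>z\<close> live in a space of finite real dimension.\<close>

lemma annihilating_poly_exists:
  fixes G :: "complex^'n^'n"
  shows "\<exists>p. p \<noteq> 0 \<and> poly_act G p z = 0"
proof -
  define N where "N = DIM(complex^'n)"
  define f where "f i = ((*v) G ^^ i) z" for i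
  have ex: "\<exists>c. (\<exists>i\<le>N. c i \<noteq> (0::real)) \<and> (\<Sum>i\<le>N. c i *\<^sub>R f i) = 0"
  proof (cases "inj_on f {..N}")
    case True
    then have "card (f ` {..N}) = Suc N" by (simp add: card_image)
    then have "dependent (f ` {..N})" by (intro dependent_biggerset) (auto simp: N_def)
    then obtain u where u: "\<exists>v\<in>f ` {..N}. u v \<noteq> 0" "(\<Sum>v\<in>f ` {..N}. u v *\<^sub>R v) = 0"
      by (auto simp: dependent_finite)
    then have "(\<Sum>i\<le>N. u (f i) *\<^sub>R f i) = 0" using True by (simp add: sum.reindex)
    then show ?thesis using u(1) by (intro exI[of _ "u \<circ> f"]) auto
  next
    case False
    then obtain i j where ij: "i \<le> N" "j \<le> N" "f i = f j" "i \<noteq> j" by (auto simp: inj_on_def)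
    define c where "c k = (if k = i then 1 else if k = j then - 1 else (0::real))" for k
    have "(\<Sum>k\<le>N. c k *\<^sub>R f k) = (\<Sum>k\<in>{i, j}. c k *\<^sub>R f k)"
      using ij by (intro sum.mono_neutral_right) (auto simp: c_def)
    also have "\<dots> = 0" using ij by (simp add: c_def)
    finally show ?thesis using ij by (intro exI[of _ c]) (auto simp: c_def)
  qed
  then obtain c where c: "\<exists>i\<le>N. c i \<noteq> (0::real)" "(\<Sum>i\<le>N. c i *\<^sub>R f i) = 0" by blast
  define p where "p = Poly (map (\<lambda>i. complex_of_real (c i)) [0..<Suc N])"
  have p: "coeff p i = (if i \<le> N then of_real (c i) else 0)" for i
    by (simp add: p_def nth_default_def del: upt_Suc)
  have "p \<noteq> 0" using c(1) p by (metis coeff_0 of_real_eq_0_iff)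
  have "degree p \<le> N" by (intro degree_le) (simp add: p)
  then have "poly_act G p z = (\<Sum>i\<le>N. coeff p i *s f i)" unfolding f_def by (rule poly_act_eq_sum)
  also have "\<dots> = (\<Sum>i\<le>N. c i *\<^sub>R f i)"
    by (simp add: p vec_eq_iff scaleR_conv_of_real[where 'a = complex])
  finally show ?thesis using c(2) \<open>p \<noteq> 0\<close> by auto
qed

text \<open>Here \<open>a\<close> dominates all other eigenvalues, and the hypothesis \<open>semisimple\<close> says that the kernel
  and the range of \<open>G - a\<close> meet only in \<open>0\<close>. Induct on the degree of a polynomial \<open>p\<close> with
  \<open>p(G) z = 0\<close> and split off a linear factor \<open>X - \<mu>\<close>. If \<open>\<bar>\<mu>\<bar> < \<bar>a\<bar>\<close>, the claim for
  \<open>(G - \<mu>) z\<close> gives the one for \<open>z\<close> through a contracting recursion. Otherwise \<open>G - \<mu>\<close> is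
  injective on the range of \<open>G - a\<close>, so the factor can be cancelled.\<close>

lemma powers_tendsto_0_on_range:
  fixes G :: "complex^'n^'n"
  assumes a: "a \<noteq> 0"
    and ev: "\<And>\<mu> w. w \<noteq> 0 \<Longrightarrow> G *v w = \<mu> *s w \<Longrightarrow> \<mu> = a \<or> norm \<mu> < norm a"
    and semisimple: "\<And>u. G *v (G *v u - a *s u) = a *s (G *v u - a *s u) \<Longrightarrow> G *v u = a *s u"
    and z: "z = G *v u - a *s u"
  shows "(\<lambda>n. (((*v) G ^^ n) z) $ i / a ^ n) \<longlonglongrightarrow> 0"
proof -
  obtain p where "p \<noteq> 0" "poly_act G p z = 0" using annihilating_poly_exists by blast
  then show ?thesis using z
  proof (induction "degree p" arbitrary: p z u)
    case 0
    then obtain c where "p = [:c:]" "c \<noteq> 0" by (metis degree_eq_zeroE pCons_0_0)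
    have "c *s z = 0" using 0(3) \<open>p = [:c:]\<close> by (simp add: poly_act_def)
    then have "z = 0" using \<open>c \<noteq> 0\<close> by simp
    moreover have "((*v) G ^^ n) 0 = 0" for n by (induction n) auto
    ultimately show ?case by simp
  next
    case (Suc d)
    then have "\<not> constant (poly p)" by (simp add: constant_degree)
    then obtain \<mu> where "poly p \<mu> = 0" using fundamental_theorem_of_algebra by blast
    then obtain q where p: "p = [:- \<mu>, 1:] * q" by (auto simp: poly_eq_0_iff_dvd)
    have "q \<noteq> 0" using Suc.prems(1) p by auto
    then have "degree p = Suc (degree q)" unfolding p by (subst degree_mult_eq) auto
    then have q: "q \<noteq> 0" "d = degree q" using Suc.hyps(2) \<open>q \<noteq> 0\<close> by auto
    define y where "y = poly_act G q z"
    have Gy: "G *v y = \<mu> *s y"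
      using Suc.prems(2) unfolding p y_def poly_act_linear_factor
      by (simp add: poly_act_diff poly_act_smult poly_act_commute)
    show ?case
    proof (cases "norm \<mu> < norm a")
      case True
      define z' where "z' = G *v z - \<mu> *s z"
      have "poly_act G q z' = 0" using Suc.prems(2) unfolding p poly_act_linear_factor z'_def .
      moreover have "z' = G *v (G *v u - \<mu> *s u) - a *s (G *v u - \<mu> *s u)"
        by (simp add: z'_def Suc.prems(3) matrix_vector_mult_diff_distrib vector_scalar_commute
            vec_eq_iff algebra_simps)
      ultimately have lim: "(\<lambda>n. (((*v) G ^^ n) z') $ i / a ^ n) \<longlonglongrightarrow> 0"
        using Suc.hyps(1)[OF q(2) q(1)] by blast
      show ?thesis
      proof (rule contraction_recursion_tendsto_0)
        show "(((*v) G ^^ Suc n) z) $ i / a ^ Suc n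
            = (\<mu> / a) * ((((*v) G ^^ n) z) $ i / a ^ n) + (((*v) G ^^ n) z') $ i / a ^ n / a" for n
          using a by (simp add: z'_def funpow_matrix_diff funpow_matrix_smult funpow_swap1 field_simps)
        show "norm (\<mu> / a) < 1" using True a by (simp add: norm_divide)
        show "(\<lambda>n. (((*v) G ^^ n) z') $ i / a ^ n / a) \<longlonglongrightarrow> 0"
          using tendsto_divide[OF lim tendsto_const[of a]] a by simp
      qed
    next
      case False
      have "y = 0"
      proof (rule ccontr)
        assume "y \<noteq> 0"
        then have "\<mu> = a" using ev[OF _ Gy] False by blast
        \<comment> \<open>\<open>y\<close> lies in the range of \<open>G - a\<close> too, since polynomials in \<open>G\<close> commute with \<open>G - a\<close>.\<close>
        define u' where "u' = poly_act G q u"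
        have y: "y = G *v u' - a *s u'"
          by (simp add: y_def u'_def Suc.prems(3) poly_act_diff poly_act_smult poly_act_commute)
        then have "G *v u' = a *s u'" using semisimple[of u'] Gy \<open>\<mu> = a\<close> by simp
        then show False using y \<open>y \<noteq> 0\<close> by simp
      qed
      then show ?thesis using Suc.hyps(1)[OF q(2) q(1)] Suc.prems(3) by (simp add: y_def)
    qed
  qed
qed

lemma dominant_eigenvalue_eqI:
  "is_dominant_eigenvalue g \<alpha> \<Longrightarrow> dominant_eigenvalue g = \<alpha>"
  unfolding dominant_eigenvalue_def by (blast intro: the_equality dominant_eigenvalue_unique)

lemma dominant_eigenvalue_other_less:
  assumes "is_dominant_eigenvalue g \<alpha>" "\<mu> \<in># eigenvalues g" "\<mu> \<noteq> \<alpha>"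
  shows "norm \<mu> < norm \<alpha>"
  using assms by (auto simp: is_dominant_eigenvalue_def in_diff_count)

text \<open>The conjugate is an eigenvalue of the same modulus.\<close>

lemma dominant_eigenvalue_real:
  assumes "is_dominant_eigenvalue g \<alpha>"
  obtains a where "\<alpha> = complex_of_real a"
proof -
  have "cnj \<alpha> \<in># eigenvalues g"
    using assms by (intro cnj_eigenvalue) (simp add: is_dominant_eigenvalue_def)
  then have "cnj \<alpha> = \<alpha>" using dominant_eigenvalue_other_less[OF assms, of "cnj \<alpha>"] by fastforce
  then show ?thesis using that complex_is_Real_iff by (metis Reals_cases Reals_cnj_iff)
qed

lemma dominant_eigenvalue_simple:
  assumes "is_dominant_eigenvalue g \<alpha>"
  shows "\<not> [:- \<alpha>, 1:]\<^sup>2 dvd charpoly (complexify g)"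
proof
  assume "[:- \<alpha>, 1:]\<^sup>2 dvd charpoly (complexify g)"
  then have "2 \<le> order \<alpha> (charpoly (complexify g))"
    using charpoly_nonzero[of "complexify g"] by (simp add: order_divides)
  then have "\<alpha> \<in># eigenvalues g - {#\<alpha>#}"
    by (simp add: eigenvalues_eq charpoly_nonzero flip: count_greater_zero_iff)
  then show False using assms by (auto simp: is_dominant_eigenvalue_def)
qed

lemma real_eigenvector_exists:
  fixes g :: "real^'n^'n"
  assumes "complex_of_real a \<in># eigenvalues g"
  shows "\<exists>v\<noteq>0. g *v v = a *\<^sub>R v"
proof -
  have "poly (map_poly complex_of_real (charpoly g)) (of_real a) = 0"
    using assms by (simp add: eigenvalues_eq charpoly_nonzero charpoly_complexify)
  then have "poly (charpoly g) a = 0" by (simp add: poly_map_poly_of_real)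
  then show ?thesis by (simp add: poly_charpoly_eq_0_iff scalar_mult_eq_scaleR)
qed

lemma charpoly_transpose: "charpoly (transpose A) = charpoly A"
proof -
  have "mat [:0, 1:] - (\<chi> i j. [:transpose A $ i $ j:])
      = transpose (mat [:0, 1:] - (\<chi> i j. [:A $ i $ j:]))"
    by (auto simp: vec_eq_iff transpose_def mat_def)
  then show ?thesis unfolding charpoly_def by (simp only: det_transpose)
qed

text \<open>The dominant eigenvalue \<open>a\<close> is a simple root, so the kernel of \<open>L = g - a\<close> is the line of \<open>v\<close>
  and there is no Jordan chain above it. By counting dimensions the range of \<open>L\<close> is the kernel of
  the left eigenvector \<open>f\<close>, and \<open>f(v) \<noteq> 0\<close> because \<open>v\<close> is not in that range. On the line
  \<open>g / a\<close> is the identity, and on the range of \<open>L\<close> its powers tend to \<open>0\<close>.\<close>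

lemma proximal_powers_tendsto_rank_one:
  fixes g :: "real^'n^'n"
  assumes inv: "invertible g" and dom: "is_dominant_eigenvalue g \<alpha>"
  obtains a v f where "\<alpha> = complex_of_real a" "a \<noteq> 0" "g *v v = a *\<^sub>R v" "f \<bullet> v = 1"
    "\<forall>x. (\<lambda>n. ((*v) g ^^ n) x /\<^sub>R a ^ n) \<longlonglongrightarrow> (f \<bullet> x) *\<^sub>R v"
proof -
  obtain a where a: "\<alpha> = complex_of_real a" using dominant_eigenvalue_real[OF dom] .
  have ev: "complex_of_real a \<in># eigenvalues g"
    using dom a by (simp add: is_dominant_eigenvalue_def)
  obtain v where v: "v \<noteq> 0" "g *v v = a *\<^sub>R v" using real_eigenvector_exists[OF ev] by blast
  have "a \<noteq> 0"
    using v invertible_mult_vector_eq_0_iff[OF inv, of v] by auto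
  have "complex_of_real a \<in># eigenvalues (transpose g)"
    using ev by (simp add: eigenvalues_def charpoly_transpose)
  then obtain f0 where f0: "f0 \<noteq> 0" "transpose g *v f0 = a *\<^sub>R f0"
    using real_eigenvector_exists by blast
  have f0g: "f0 \<bullet> (g *v x) = a * (f0 \<bullet> x)" for x
    using f0(2) by (metis dot_lmul_matrix inner_scaleR_left transpose_matrix_vector)
  have chain: "\<exists>k. u = k *s complex_vec v"
    if "complexify g *v u = of_real a *s u + c *s complex_vec v" for u c
  proof (rule ccontr)
    assume "\<nexists>k. u = k *s complex_vec v"
    moreover have "complexify g *v complex_vec v = of_real a *s complex_vec v"
      by (simp add: complexify_mult_complex_vec v vec_eq_iff)
    ultimately have "[:- of_real a, 1:]\<^sup>2 dvd charpoly (complexify g)"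
      using double_root_of_charpoly[OF _ _ that] v by auto
    then show False using dominant_eigenvalue_simple[OF dom] a by simp
  qed
  have chain_real: "\<exists>k. u = k *\<^sub>R v" if "g *v u = a *\<^sub>R u + c *\<^sub>R v" for u c
  proof -
    have "complexify g *v complex_vec u = of_real a *s complex_vec u + of_real c *s complex_vec v"
      by (simp add: complexify_mult_complex_vec that vec_eq_iff)
    then obtain k where k: "complex_vec u = k *s complex_vec v" using chain by blast
    obtain i where i: "v $ i \<noteq> 0" using v by (auto simp: vec_eq_iff)
    have "complex_of_real (u $ i) = k * of_real (v $ i)" using arg_cong[OF k, of "\<lambda>x. x $ i"] by simp
    define c where "c = u $ i / v $ i"
    have "k = of_real c" using \<open>complex_of_real (u $ i) = _\<close> i by (simp add: c_def field_simps)
    then have "complex_of_real (u $ j) = of_real (c * v $ j)" for j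
      using arg_cong[OF k, of "\<lambda>x. x $ j"] by simp
    then have "u $ j = c * v $ j" for j unfolding of_real_eq_iff .
    then have "u = c *\<^sub>R v" by (simp add: vec_eq_iff)
    then show ?thesis by blast
  qed
  define L where "L x = g *v x - a *\<^sub>R x" for x
  have linL: "linear L"
    unfolding L_def by (intro linear_compose_sub matrix_vector_mul_linear linear_scale_self)
  have kerL: "\<exists>k. x = k *\<^sub>R v" if "L x = 0" for x
    using chain_real[of x 0] that by (simp add: L_def)
  have rangeL: "range L = {x. f0 \<bullet> x = 0}"
  proof (rule subspace_dim_equal)
    show "subspace (range L)" using linL by (rule linear_subspace_image) simp
    show "subspace {x. f0 \<bullet> x = 0}" by (rule subspace_hyperplane)
    show "range L \<subseteq> {x. f0 \<bullet> x = 0}" by (auto simp: L_def inner_diff_right f0g)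
    \<comment> \<open>\<open>L\<close> is injective on the complement of its kernel, so its range is at least a hyperplane.\<close>
    have sub: "subspace {x. v \<bullet> x = 0}" by (rule subspace_hyperplane)
    have "inj_on L {x. v \<bullet> x = 0}"
    proof (rule inj_onI)
      fix x y assume xy: "x \<in> {x. v \<bullet> x = 0}" "y \<in> {x. v \<bullet> x = 0}" "L x = L y"
      then have "L (x - y) = 0" by (simp add: linear_diff[OF linL])
      then obtain k where k: "x - y = k *\<^sub>R v" using kerL by blast
      have "v \<bullet> (x - y) = 0" using xy by (simp add: inner_diff_right)
      then show "x = y" using k v(1) by simp
    qed
    then have "dim (L ` {x. v \<bullet> x = 0}) = dim {x. v \<bullet> x = 0}"
      using sub by (intro dim_image_eq[OF linL]) (simp only: span_eq_iff[THEN iffD2])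
    also have "\<dots> = dim {x. f0 \<bullet> x = 0}" using v(1) f0(1) by (simp add: dim_hyperplane)
    finally show "dim {x. f0 \<bullet> x = 0} \<le> dim (range L)"
      using dim_subset[of "L ` {x. v \<bullet> x = 0}" "range L"] by auto
  qed
  have "f0 \<bullet> v \<noteq> 0"
  proof
    assume "f0 \<bullet> v = 0"
    then have "v \<in> range L" using rangeL by simp
    then obtain u where u: "v = L u" by blast
    then have "g *v u = a *\<^sub>R u + 1 *\<^sub>R v" by (simp add: L_def)
    then obtain k where "u = k *\<^sub>R v" using chain_real[of u 1] by blast
    then have "L u = 0" by (simp add: L_def v matrix_vector_mult_scaleR)
    then show False using u v by simp
  qed
  define f where "f = f0 /\<^sub>R (f0 \<bullet> v)"
  have fv: "f \<bullet> v = 1" using \<open>f0 \<bullet> v \<noteq> 0\<close> by (simp add: f_def)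
  have f_eq: "f \<bullet> x = 0 \<longleftrightarrow> f0 \<bullet> x = 0" for x using \<open>f0 \<bullet> v \<noteq> 0\<close> by (simp add: f_def)
  have funpow_v: "((*v) g ^^ n) v = a ^ n *\<^sub>R v" for n
    by (induction n) (simp_all add: v matrix_vector_mult_scaleR)
  have funpow_complex: "((*v) (complexify g) ^^ n) (complex_vec x) = complex_vec (((*v) g ^^ n) x)" for n x
    by (induction n) (simp_all add: complexify_mult_complex_vec)
  have lim0: "(\<lambda>n. ((*v) g ^^ n) x /\<^sub>R a ^ n) \<longlonglongrightarrow> 0" if fx: "f \<bullet> x = 0" for x
  proof (rule vec_tendstoI)
    fix i
    have "x \<in> range L" using fx f_eq rangeL by simp
    then obtain u where u: "x = L u" by blast
    have "(\<lambda>n. (((*v) (complexify g) ^^ n) (complex_vec x)) $ i / of_real a ^ n) \<longlonglongrightarrow> 0"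
    proof (rule powers_tendsto_0_on_range)
      show "complex_of_real a \<noteq> 0" using \<open>a \<noteq> 0\<close> by simp
      show "\<mu> = complex_of_real a \<or> cmod \<mu> < cmod (complex_of_real a)"
        if "w \<noteq> 0" "complexify g *v w = \<mu> *s w" for \<mu> w
        using dominant_eigenvalue_other_less[OF dom, of \<mu>] that in_eigenvalues_iff[of \<mu> g] a by blast
      show "complexify g *v u = of_real a *s u"
        if "complexify g *v (complexify g *v u - of_real a *s u) = of_real a *s (complexify g *v u - of_real a *s u)" for u
      proof -
        define y where "y = complexify g *v u - of_real a *s u"
        have gv: "complexify g *v complex_vec v = of_real a *s complex_vec v"
          by (simp add: complexify_mult_complex_vec v vec_eq_iff)
        have "complexify g *v y = of_real a *s y + 0 *s complex_vec v"
          using that unfolding y_def by (simp add: vec_eq_iff)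
        then obtain k where k: "y = k *s complex_vec v" using chain by blast
        then have "complexify g *v u = of_real a *s u + k *s complex_vec v"
          by (simp add: y_def algebra_simps)
        then obtain l where u_eq: "u = l *s complex_vec v" using chain by blast
        show ?thesis unfolding u_eq vector_scalar_commute gv by (simp add: vec_eq_iff)
      qed
      show "complex_vec x = complexify g *v complex_vec u - of_real a *s complex_vec u"
        by (simp add: u L_def complexify_mult_complex_vec vec_eq_iff)
    qed
    then have "(\<lambda>n. complex_of_real ((((*v) g ^^ n) x /\<^sub>R a ^ n) $ i)) \<longlonglongrightarrow> of_real (0 $ i)"
      by (simp add: funpow_complex divide_inverse mult.commute)
    then show "(\<lambda>n. (((*v) g ^^ n) x /\<^sub>R a ^ n) $ i) \<longlonglongrightarrow> 0 $ i"
      by (rule tendsto_of_real_iff[THEN iffD1])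
  qed
  have lim: "(\<lambda>n. ((*v) g ^^ n) x /\<^sub>R a ^ n) \<longlonglongrightarrow> (f \<bullet> x) *\<^sub>R v" for x
  proof -
    define y where "y = x - (f \<bullet> x) *\<^sub>R v"
    have "((*v) g ^^ n) x /\<^sub>R a ^ n = ((*v) g ^^ n) y /\<^sub>R a ^ n + (f \<bullet> x) *\<^sub>R v" for n
      using funpow_matrix_smult[of n g "f \<bullet> x" v] \<open>a \<noteq> 0\<close>
      by (simp add: y_def funpow_matrix_diff funpow_v scalar_mult_eq_scaleR scaleR_diff_right)
    moreover have "(\<lambda>n. ((*v) g ^^ n) y /\<^sub>R a ^ n) \<longlonglongrightarrow> 0"
      using fv by (intro lim0) (simp add: y_def inner_diff_right)
    ultimately show ?thesis using tendsto_add[OF _ tendsto_const] by fastforce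
  qed
  show ?thesis by (rule that[OF a \<open>a \<noteq> 0\<close> v(2) fv allI[OF lim]])
qed

section \<open>Eigenvalues near a rank one matrix\<close>

lemma max_norm_normalised_eigenvector:
  fixes w :: "complex^'n"
  assumes "w \<noteq> 0" "G *v w = z *s w"
  obtains w' :: "complex^'n" and i where "G *v w' = z *s w'" "w' $ i = 1" "\<And>j. norm (w' $ j) \<le> 1"
proof -
  have "Max (range (\<lambda>j. norm (w $ j))) \<in> range (\<lambda>j. norm (w $ j))" by (rule Max_in) auto
  then obtain i where i: "Max (range (\<lambda>j. norm (w $ j))) = norm (w $ i)" by (rule rangeE)
  have le: "norm (w $ j) \<le> norm (w $ i)" for j unfolding i[symmetric] by (rule Max_ge) auto
  have nz: "w $ i \<noteq> 0"
  proof
    assume "w $ i = 0"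
    then have "w = 0" using le by (simp add: vec_eq_iff)
    then show False using assms by simp
  qed
  show ?thesis
  proof (rule that)
    show "G *v (inverse (w $ i) *s w) = z *s (inverse (w $ i) *s w)"
      by (simp add: vector_scalar_commute assms(2) vec_eq_iff)
    show "(inverse (w $ i) *s w) $ i = 1" using nz by simp
    show "norm ((inverse (w $ i) *s w) $ j) \<le> 1" for j
      using le[of j] nz by (simp add: norm_mult norm_inverse norm_divide divide_le_eq field_simps)
  qed
qed

text \<open>The constant \<open>\<delta>\<close> measures the distance of \<open>M / s\<close> from the rank one matrix \<open>v k\<^sup>T\<close>, whose
  eigenvalues are \<open>0\<close> and \<open>c = k(v)\<close>. If an eigenvector \<open>w\<close> of \<open>M\<close> were one of \<open>v k\<^sup>T\<close>, with
  eigenvalue \<open>t\<close>, then \<open>t w = \<kappa> v\<close> with \<open>\<kappa> = k(w)\<close>, and applying \<open>k\<close> would give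
  \<open>(t - c) \<kappa> = 0\<close>: so \<open>t = c\<close>, or \<open>\<kappa> = 0\<close> and then \<open>t = 0\<close>. The proof is this argument with
  the error \<open>r = t w - \<kappa> v\<close> kept.\<close>

lemma eigenvalue_near_rank_one:
  fixes M :: "real^'n^'n" and v k :: "real^'n" and s :: real
  defines "c \<equiv> k \<bullet> v"
    and "\<delta> \<equiv> (\<Sum>i\<in>UNIV. \<Sum>j\<in>UNIV. \<bar>M $ i $ j / s - v $ i * k $ j\<bar>)"
    and "K \<equiv> (\<Sum>i\<in>UNIV. \<bar>k $ i\<bar>)" and "V \<equiv> (\<Sum>i\<in>UNIV. \<bar>v $ i\<bar>)"
  assumes s: "s \<noteq> 0" and z: "z \<in># eigenvalues M" and e: "e > 0"
    and small: "\<delta> + \<delta> * K / e * V < e"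
  shows "norm (z / of_real s) < e \<or> norm (z / of_real s - of_real c) < e"
proof (rule ccontr)
  assume far: "\<not> (norm (z / of_real s) < e \<or> norm (z / of_real s - of_real c) < e)"
  define t where "t = z / of_real s"
  have t: "norm t \<ge> e" "norm (t - of_real c) \<ge> e" using far by (auto simp: t_def)
  obtain w0 where "w0 \<noteq> 0" "complexify M *v w0 = z *s w0" using z in_eigenvalues_iff by blast
  then obtain w :: "complex^'n" and i0 where w: "complexify M *v w = z *s w" "w $ i0 = 1" "\<And>j. norm (w $ j) \<le> 1"
    using max_norm_normalised_eigenvector by blast
  define \<kappa> where "\<kappa> = (\<Sum>j\<in>UNIV. of_real (k $ j) * w $ j)"
  define r where "r i = t * w $ i - of_real (v $ i) * \<kappa>" for i
  have r_eq: "r i = (\<Sum>j\<in>UNIV. of_real (M $ i $ j / s - v $ i * k $ j) * w $ j)" for i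
  proof -
    have "(\<Sum>j\<in>UNIV. of_real (M $ i $ j) * w $ j) = z * w $ i"
      using arg_cong[OF w(1), of "\<lambda>x. x $ i"] by (simp add: matrix_vector_mult_def)
    then have "t * w $ i = (\<Sum>j\<in>UNIV. of_real (M $ i $ j / s) * w $ j)"
      using s by (simp add: t_def sum_divide_distrib[symmetric])
    then show ?thesis
      by (simp add: r_def \<kappa>_def sum_distrib_left left_diff_distrib sum_subtractf mult.assoc)
  qed
  have row_le: "norm (r i) \<le> (\<Sum>j\<in>UNIV. \<bar>M $ i $ j / s - v $ i * k $ j\<bar>)" for i
  proof -
    have "norm (r i) \<le> (\<Sum>j\<in>UNIV. norm (of_real (M $ i $ j / s - v $ i * k $ j) * w $ j))"
      unfolding r_eq by (rule norm_sum)
    also have "\<dots> \<le> (\<Sum>j\<in>UNIV. \<bar>M $ i $ j / s - v $ i * k $ j\<bar>)"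
    proof (rule sum_mono)
      fix j
      show "norm (of_real (M $ i $ j / s - v $ i * k $ j) * w $ j) \<le> \<bar>M $ i $ j / s - v $ i * k $ j\<bar>"
        using mult_left_le[OF w(3)[of j], of "\<bar>M $ i $ j / s - v $ i * k $ j\<bar>"]
        by (simp only: norm_mult norm_of_real abs_ge_zero)
    qed
    finally show ?thesis .
  qed
  have r_le: "norm (r i) \<le> \<delta>" for i
    using row_le[of i] member_le_sum[of i UNIV "\<lambda>i. \<Sum>j\<in>UNIV. \<bar>M $ i $ j / s - v $ i * k $ j\<bar>"]
    by (simp add: \<delta>_def sum_nonneg)
  have "(t - of_real c) * \<kappa> = (\<Sum>i\<in>UNIV. of_real (k $ i) * r i)"
    by (simp add: r_def right_diff_distrib sum_subtractf \<kappa>_def c_def inner_vec_def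
        sum_distrib_left sum_distrib_right left_diff_distrib mult_ac)
  also have "norm \<dots> \<le> (\<Sum>i\<in>UNIV. \<bar>k $ i\<bar> * \<delta>)"
    by (rule order_trans[OF norm_sum]) (auto intro!: sum_mono mult_left_mono r_le simp: norm_mult)
  finally have "norm (t - of_real c) * norm \<kappa> \<le> \<delta> * K"
    by (simp add: norm_mult K_def sum_distrib_left[symmetric] mult.commute)
  then have "e * norm \<kappa> \<le> \<delta> * K"
    using mult_right_mono[OF t(2) norm_ge_zero[of \<kappa>]] by linarith
  then have \<kappa>: "norm \<kappa> \<le> \<delta> * K / e" using e by (simp add: field_simps)
  have "t = r i0 + of_real (v $ i0) * \<kappa>" by (simp add: r_def w(2))
  then have "norm t \<le> norm (r i0) + norm (of_real (v $ i0) * \<kappa>)"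
    using norm_triangle_ineq by metis
  also have "\<dots> \<le> \<delta> + \<delta> * K / e * V"
  proof (rule add_mono[OF r_le])
    have "\<bar>v $ i0\<bar> \<le> V" unfolding V_def by (rule member_le_sum) auto
    then have "norm \<kappa> * \<bar>v $ i0\<bar> \<le> \<delta> * K / e * V"
      using \<kappa> by (intro mult_mono) (auto intro: order_trans[OF norm_ge_zero])
    then show "norm (of_real (v $ i0) * \<kappa>) \<le> \<delta> * K / e * V" by (simp add: norm_mult mult.commute)
  qed
  finally show False using small t(1) by linarith
qed

lemma sum_mset_near:
  fixes M :: "complex multiset"
  assumes "\<And>z. z \<in># M \<Longrightarrow> norm (f z - h z) \<le> e"
  shows "norm (sum_mset (image_mset f M) - sum_mset (image_mset h M)) \<le> e * size M"
  using assms
proof (induction M)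
  case (add x M)
  have "norm (f x - h x) + norm (sum_mset (image_mset f M) - sum_mset (image_mset h M)) \<le> e + e * size M"
    using add by (intro add_mono) auto
  then show ?case
    using norm_triangle_ineq[of "f x - h x" "sum_mset (image_mset f M) - sum_mset (image_mset h M)"]
    by (simp add: algebra_simps)
qed simp

text \<open>Every eigenvalue of \<open>M n / s n\<close> is eventually close to \<open>0\<close> or to \<open>c = k(v)\<close>. If \<open>N\<close> of them are
  close to \<open>c\<close>, then their sum, the trace, is close to \<open>N c\<close>; but the trace converges to
  \<open>c\<close>, hence \<open>N = 1\<close>, and this eigenvalue is dominant.\<close>

lemma dominant_near_rank_one:
  fixes M :: "nat \<Rightarrow> real^'n^'n" and v k :: "real^'n" and s :: "nat \<Rightarrow> real"
  assumes s: "\<And>n. s n \<noteq> 0" and c: "k \<bullet> v \<noteq> 0" and e: "e > 0"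
    and lim: "\<And>i j. (\<lambda>n. M n $ i $ j / s n) \<longlonglongrightarrow> v $ i * k $ j"
  shows "\<forall>\<^sub>F n in sequentially. \<exists>z. is_dominant_eigenvalue (M n) z \<and>
      norm (z / of_real (s n) - of_real (k \<bullet> v)) < e"
proof -
  define c where "c = k \<bullet> v"
  define d where "d = real CARD('n)"
  have d: "d \<ge> 1" by (simp add: d_def Suc_le_eq)
  \<comment> \<open>Small enough that the total error \<open>(d + 1) e'\<close> in the comparison of traces stays below \<open>\<bar>c\<bar>\<close>, and
  that numbers close to \<open>0\<close> are smaller than those close to \<open>c\<close>.\<close>
  define e' where "e' = min e (\<bar>c\<bar> / (2 * (d + 1)))"
  have c0: "\<bar>c\<bar> > 0" using c by (simp add: c_def)
  have e': "e' > 0" "e' \<le> e" using e c0 d by (auto simp: e'_def)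
  have "e' \<le> \<bar>c\<bar> / (2 * (d + 1))" by (simp add: e'_def)
  then have "2 * (d + 1) * e' \<le> \<bar>c\<bar>" using d by (simp add: field_simps)
  then have "2 * (d * e') + 2 * e' \<le> \<bar>c\<bar>" by (simp add: algebra_simps)
  moreover have "0 < d * e'" using d e'(1) by simp
  ultimately have e'c: "d * e' + e' < \<bar>c\<bar>" "2 * e' < \<bar>c\<bar>" using e'(1) by linarith+
  define \<delta> where "\<delta> n = (\<Sum>i\<in>UNIV. \<Sum>j\<in>UNIV. \<bar>M n $ i $ j / s n - v $ i * k $ j\<bar>)" for n
  define K where "K = (\<Sum>i\<in>UNIV. \<bar>k $ i\<bar>)"
  define V where "V = (\<Sum>i\<in>UNIV. \<bar>v $ i\<bar>)"
  have \<delta>0: "\<delta> \<longlonglongrightarrow> 0"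
    unfolding \<delta>_def using lim
    by (intro tendsto_null_sum tendsto_rabs_zero) (simp add: LIM_zero)
  have "(\<lambda>n. \<delta> n + \<delta> n * K / e' * V) \<longlonglongrightarrow> 0 + 0 * K / e' * V"
    by (intro tendsto_intros \<delta>0) (use e' in auto)
  then have "\<forall>\<^sub>F n in sequentially. \<delta> n + \<delta> n * K / e' * V < e'"
    using e'(1) by (intro order_tendstoD) auto
  moreover have "(\<lambda>n. trace (M n) / s n) \<longlonglongrightarrow> c"
    unfolding trace_def c_def inner_vec_def sum_divide_distrib
    using lim by (intro tendsto_sum) (simp add: mult.commute)
  then have "\<forall>\<^sub>F n in sequentially. \<bar>trace (M n) / s n - c\<bar> < e'"
    using e'(1) by (auto simp: tendsto_iff dist_real_def)
  ultimately show ?thesis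
  proof eventually_elim
    case (elim n)
    define E where "E = eigenvalues (M n)"
    define f where "f z = z / of_real (s n)" for z :: complex
    define near where "near z \<longleftrightarrow> norm (f z - of_real c) < e'" for z
    have near: "norm (f z) < e'" if "z \<in># E" "\<not> near z" for z
      using eigenvalue_near_rank_one[OF s[of n] _ e'(1), of z "M n" v k] that elim(1)
      unfolding E_def f_def near_def \<delta>_def K_def V_def c_def by blast
    \<comment> \<open>\<open>h\<close> rounds each rescaled eigenvalue to the eigenvalue of the limit next to it.\<close>
    define h where "h z = (if near z then complex_of_real c else 0)" for z
    define N where "N = size (filter_mset near E)"
    have h_sum: "sum_mset (image_mset h F) = of_nat (size (filter_mset near F)) * of_real c" for F
      by (induction F) (auto simp: h_def algebra_simps)
    have "sum_mset (image_mset f F) = sum_mset F / of_real (s n)" for F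
      by (induction F) (simp_all add: f_def add_divide_distrib)
    then have "sum_mset (image_mset f E) = sum_mset E / of_real (s n)" .
    also have "\<dots> = of_real (trace (M n) / s n)" by (simp add: E_def sum_eigenvalues)
    finally have f_sum: "sum_mset (image_mset f E) = of_real (trace (M n) / s n)" .
    have "norm (sum_mset (image_mset f E) - sum_mset (image_mset h E)) \<le> e' * size E"
    proof (rule sum_mset_near)
      fix z assume "z \<in># E"
      then show "norm (f z - h z) \<le> e'" using near[of z] by (auto simp: h_def near_def less_imp_le)
    qed
    then have "norm (complex_of_real (trace (M n) / s n - N * c)) \<le> e' * d"
      using size_eigenvalues[of "M n"] by (simp add: h_sum f_sum N_def d_def flip: E_def)
    then have "\<bar>trace (M n) / s n - N * c\<bar> \<le> e' * d" by (simp only: norm_of_real)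
    then have "\<bar>(real N - 1) * c\<bar> < e' * d + e'" using elim(2) by (simp add: algebra_simps)
    then have "\<bar>real N - 1\<bar> * \<bar>c\<bar> < 1 * \<bar>c\<bar>" using e'c(1) by (simp add: abs_mult mult.commute)
    then have "\<bar>real N - 1\<bar> < 1" using c0 by (simp only: mult_less_cancel_right)
    then have "N = 1" by linarith
    then obtain z where z: "filter_mset near E = {#z#}" using size_1_singleton_mset N_def by metis
    then have "z \<in># filter_mset near E" by simp
    then have zE: "z \<in># E" "near z" by simp_all
    have "norm \<mu> < norm z" if \<mu>: "\<mu> \<in># E - {#z#}" for \<mu>
    proof -
      have empty: "filter_mset near (E - {#z#}) = {#}" using z zE by simp
      have "\<not> near \<mu>"
      proof
        assume "near \<mu>"
        then have "\<mu> \<in># filter_mset near (E - {#z#})" using \<mu> unfolding set_mset_filter by blast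
        then show False unfolding empty by simp
      qed
      then have "norm (f \<mu>) < e'" using near in_diffD[OF \<mu>] by blast
      also have "e' < norm (f z)"
        using zE(2) norm_triangle_ineq3[of "f z" "of_real c"] e'c(2) by (simp add: near_def)
      finally show ?thesis using s[of n] by (simp add: f_def norm_divide divide_less_cancel)
    qed
    then have "is_dominant_eigenvalue (M n) z" using zE by (simp add: is_dominant_eigenvalue_def E_def)
    then show ?case using zE(2) e'(2) by (auto simp: near_def f_def c_def)
  qed
qed

lemma funpow_matrix_mult_vec:
  fixes g :: "'a::semiring_1^'n^'n"
  shows "((\<lambda>M. g ** M) ^^ n) h *v x = ((*v) g ^^ n) (h *v x)"
  by (induction n) (simp_all flip: matrix_vector_mul_assoc)

section \<open>Density of the logarithmic spectrum\<close>

text \<open>The span of a tail of the orbit is mapped into itself by \<open>g\<close>, hence onto itself since \<open>g\<close> is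
  injective. So it contains the whole orbit, including \<open>z\<close>.\<close>

lemma functional_vanishes_on_orbit:
  fixes g :: "real^'n^'n"
  assumes inv: "invertible g" and tail: "\<And>n. n \<ge> N \<Longrightarrow> p \<bullet> ((*v) g ^^ n) z = 0"
  shows "p \<bullet> z = 0"
proof -
  define U where "U = span ((\<lambda>n. ((*v) g ^^ n) z) ` {N..})"
  have subU: "subspace U" by (simp add: U_def)
  have lin: "linear ((*v) g)" by (rule matrix_vector_mul_linear)
  have inj: "inj ((*v) g)" by (rule inj_matrix_vector_mult[OF inv])
  have "((*v) g) ` ((\<lambda>n. ((*v) g ^^ n) z) ` {N..}) \<subseteq> (\<lambda>n. ((*v) g ^^ n) z) ` {N..}"
  proof safe
    fix n assume "N \<le> n"
    then show "g *v ((*v) g ^^ n) z \<in> (\<lambda>n. ((*v) g ^^ n) z) ` {N..}"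
      by (intro image_eqI[of _ _ "Suc n"]) auto
  qed
  then have "(*v) g ` U \<subseteq> U"
    unfolding U_def using linear_span_image[OF lin] span_mono by metis
  moreover have "dim ((*v) g ` U) = dim U"
    by (intro dim_image_eq[OF lin] inj_on_subset[OF inj]) simp
  ultimately have gU: "(*v) g ` U = U"
    using subU linear_subspace_image[OF lin subU] by (intro subspace_dim_equal) auto
  have backward: "y \<in> U" if gy: "g *v y \<in> U" for y
  proof -
    have "g *v y \<in> (*v) g ` U" using gy gU by simp
    then show ?thesis using inj by (simp add: inj_image_mem_iff)
  qed
  have "m \<le> N \<Longrightarrow> ((*v) g ^^ (N - m)) z \<in> U" for m
  proof (induction m)
    case 0
    then show ?case by (auto simp: U_def intro: span_base)
  next
    case (Suc m)
    have "Suc (N - Suc m) = N - m" using Suc.prems by simp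
    moreover have "((*v) g ^^ (N - m)) z \<in> U" using Suc.IH Suc.prems Suc_leD by blast
    ultimately have "((*v) g ^^ Suc (N - Suc m)) z \<in> U" by metis
    then show ?case using backward by simp
  qed
  from this[of N] have "z \<in> U" by simp
  moreover have "U \<subseteq> {x. p \<bullet> x = 0}"
    unfolding U_def using tail by (intro span_minimal subspace_hyperplane) auto
  ultimately show ?thesis by auto
qed

text \<open>The matrices \<open>g\<^sup>n h / a\<^sup>n\<close> converge to the rank one matrix \<open>v k\<^sup>T\<close> with \<open>k = f \<circ> h\<close>.\<close>

lemma dominant_eigenvalue_power_mult_tendsto:
  fixes g h :: "real^'n^'n"
  assumes a: "a \<noteq> 0" and c: "f \<bullet> (h *v v) \<noteq> 0"
    and lim: "\<forall>x. (\<lambda>n. ((*v) g ^^ n) x /\<^sub>R a ^ n) \<longlonglongrightarrow> (f \<bullet> x) *\<^sub>R v"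
  defines "M \<equiv> \<lambda>n. ((\<lambda>A. g ** A) ^^ n) h"
  shows "\<forall>\<^sub>F n in sequentially. proximal (M n)"
    and "(\<lambda>n. dominant_eigenvalue (M n) / of_real (a ^ n)) \<longlonglongrightarrow> of_real (f \<bullet> (h *v v))"
proof -
  define k where "k = f v* h"
  have k: "k \<bullet> x = f \<bullet> (h *v x)" for x by (simp add: k_def dot_lmul_matrix)
  have col: "M n $ i $ j = ((*v) g ^^ n) (h *v axis j 1) $ i" for n i j
    using funpow_matrix_mult_vec[where g = g and n = n and h = h and x = "axis j 1"] by (simp add: M_def matrix_vector_mult_basis column_def vec_eq_iff)
  have entries: "(\<lambda>n. M n $ i $ j / a ^ n) \<longlonglongrightarrow> v $ i * k $ j" for i j
  proof -
    have kj: "f \<bullet> (h *v axis j 1) = k $ j" by (simp add: k[symmetric] inner_axis)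
    show ?thesis
      using tendsto_vec_nth[OF lim[rule_format, of "h *v axis j 1"], of i] by (simp add: kj col divide_inverse mult.commute)
  qed
  have near: "\<forall>\<^sub>F n in sequentially. \<exists>z. is_dominant_eigenvalue (M n) z \<and>
      norm (z / of_real (a ^ n) - of_real (f \<bullet> (h *v v))) < e" if "e > 0" for e
    using dominant_near_rank_one[of "\<lambda>n. a ^ n" k v e M] that a c entries by (simp add: k)
  show "\<forall>\<^sub>F n in sequentially. proximal (M n)"
    using near[of 1] by (rule eventually_mono) (auto simp: proximal_def)
  show "(\<lambda>n. dominant_eigenvalue (M n) / of_real (a ^ n)) \<longlonglongrightarrow> of_real (f \<bullet> (h *v v))"
  proof (rule tendstoI)
    fix e :: real assume "e > 0"
    from near[OF this] show "\<forall>\<^sub>F n in sequentially.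
        dist (dominant_eigenvalue (M n) / of_real (a ^ n)) (of_real (f \<bullet> (h *v v))) < e"
      by (rule eventually_mono) (auto simp: dist_norm dest!: dominant_eigenvalue_eqI)
  qed
qed

theorem corollary4p8:
  fixes \<Gamma> :: "(real^'n^'n) set"
  assumes "CARD('n) > 1"
    and "sub_semigroup_GL \<Gamma>"
    and "strongly_irreducible \<Gamma>"
    and "\<exists>g\<in>\<Gamma>. proximal g"
  shows "closure (group_closure (log_spectrum \<Gamma>)) = UNIV"
proof (rule ccontr)
  define H where "H = closure (group_closure (log_spectrum \<Gamma>))"
  assume "closure (group_closure (log_spectrum \<Gamma>)) \<noteq> UNIV"
  then have "H \<noteq> UNIV" by (simp add: H_def)
  have closedH: "closed H" by (simp add: H_def)
  have diffH: "x - y \<in> H" if "x \<in> H" "y \<in> H" for x y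
    using that closure_additive_subgroup_diff[OF group_closure.diff] unfolding H_def by blast
  obtain e where e: "e > 0" and discrete: "\<And>x. x \<in> H \<Longrightarrow> \<bar>x\<bar> < e \<Longrightarrow> x = 0"
    using additive_subgroup_of_real_dense[OF diffH] \<open>H \<noteq> UNIV\<close> closedH by (auto simp: closure_closed)
  have inv: "invertible h" if "h \<in> \<Gamma>" for h
    using assms(2) that by (auto simp: sub_semigroup_GL_def)
  have mul: "h ** h' \<in> \<Gamma>" if "h \<in> \<Gamma>" "h' \<in> \<Gamma>" for h h'
    using assms(2) that by (auto simp: sub_semigroup_GL_def)
  have spec: "ln (norm (dominant_eigenvalue h)) \<in> H" if "h \<in> \<Gamma>" "proximal h" for h
  proof -
    have "ln (norm (dominant_eigenvalue h)) \<in> log_spectrum \<Gamma>"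
      using that by (auto simp: log_spectrum_def proximal_elements_def)
    then show ?thesis unfolding H_def
      by (intro closure_subset[THEN subsetD] group_closure.base) simp
  qed
  obtain g where g: "g \<in> \<Gamma>" "proximal g" using assms(4) by blast
  then obtain \<alpha> where dom: "is_dominant_eigenvalue g \<alpha>" by (auto simp: proximal_def)
  obtain a v f where a: "\<alpha> = complex_of_real a" "a \<noteq> 0" and v: "g *v v = a *\<^sub>R v" and fv: "f \<bullet> v = 1"
    and lim: "\<forall>x. (\<lambda>n. ((*v) g ^^ n) x /\<^sub>R a ^ n) \<longlonglongrightarrow> (f \<bullet> x) *\<^sub>R v"
    by (rule proximal_powers_tendsto_rank_one[OF inv[OF g(1)] dom])
  have nz: "f \<noteq> 0" "v \<noteq> 0" using fv by auto
  have power: "((\<lambda>A. g ** A) ^^ n) h \<in> \<Gamma>" if "h \<in> \<Gamma>" for n h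
    using that by (induction n) (auto intro: mul g)
  have aH: "ln \<bar>a\<bar> \<in> H" using spec[OF g] a by (simp add: dominant_eigenvalue_eqI[OF dom])
  \<comment> \<open>Dividing a number by a power of \<open>a\<close> does not take its logarithm out of \<open>H\<close>.\<close>
  have shiftH: "x - real n * ln \<bar>a\<bar> \<in> H" if "x \<in> H" for x n
  proof (induction n)
    case (Suc n)
    then show ?case using diffH[OF Suc aH] by (simp add: algebra_simps)
  qed (use that in simp)
  have coeffH: "ln \<bar>f \<bullet> (h *v v)\<bar> \<in> H" if h: "h \<in> \<Gamma>" "f \<bullet> (h *v v) \<noteq> 0" for h
  proof -
    define M where "M n = ((\<lambda>A. g ** A) ^^ n) h" for n
    define q where "q n = dominant_eigenvalue (M n) / of_real (a ^ n)" for n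
    note M_lim = dominant_eigenvalue_power_mult_tendsto[OF a(2) h(2) lim, folded M_def, folded q_def]
    have "(\<lambda>n. ln (norm (q n))) \<longlonglongrightarrow> ln (norm (complex_of_real (f \<bullet> (h *v v))))"
      by (intro tendsto_ln tendsto_norm M_lim(2)) (use h(2) in simp)
    moreover have "\<forall>\<^sub>F n in sequentially. q n \<noteq> 0"
      using h(2) by (intro tendsto_imp_eventually_ne[OF M_lim(2)]) simp
    with M_lim(1) have "\<forall>\<^sub>F n in sequentially. ln (norm (q n)) \<in> H"
    proof eventually_elim
      case (elim n)
      then have "dominant_eigenvalue (M n) \<noteq> 0" using h(2) by (auto simp: q_def)
      then have "ln (norm (q n)) = ln (norm (dominant_eigenvalue (M n))) - real n * ln \<bar>a\<bar>"
        using a(2) by (simp add: q_def norm_divide norm_power ln_div ln_realpow)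
      then show ?case using shiftH[OF spec[OF power[OF h(1)]]] elim by (simp add: M_def)
    qed
    ultimately have "ln (norm (complex_of_real (f \<bullet> (h *v v)))) \<in> H"
      using Lim_in_closed_set[OF closedH, of "\<lambda>n. ln (norm (q n))" sequentially] by simp
    then show ?thesis by simp
  qed
  \<comment> \<open>The error in \<open>f(\<gamma> g\<^sup>n \<delta> v) \<approx> a\<^sup>n f(\<gamma> v) f(\<delta> v)\<close> vanishes for large \<open>n\<close> by discreteness, and then
  already for \<open>n = 0\<close> by invertibility of \<open>g\<close>.\<close>
  have vanish: "f \<bullet> (\<gamma> *v (\<delta> *v v - (f \<bullet> (\<delta> *v v)) *\<^sub>R v)) = 0"
    if \<gamma>: "\<gamma> \<in> \<Gamma>" "f \<bullet> (\<gamma> *v v) \<noteq> 0" and \<delta>: "\<delta> \<in> \<Gamma>" "f \<bullet> (\<delta> *v v) \<noteq> 0" for \<gamma> \<delta>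
  proof -
    define z where "z = \<delta> *v v - (f \<bullet> (\<delta> *v v)) *\<^sub>R v"
    define t where "t n = f \<bullet> (\<gamma> *v (((*v) g ^^ n) (\<delta> *v v) /\<^sub>R a ^ n))" for n
    define t\<^sub>0 where "t\<^sub>0 = (f \<bullet> (\<delta> *v v)) * (f \<bullet> (\<gamma> *v v))"
    have t0: "t\<^sub>0 \<noteq> 0" using \<gamma> \<delta> by (simp add: t\<^sub>0_def)
    have "t \<longlonglongrightarrow> f \<bullet> (\<gamma> *v ((f \<bullet> (\<delta> *v v)) *\<^sub>R v))"
      unfolding t_def
      by (intro tendsto_inner tendsto_const bounded_linear.tendsto[OF matrix_vector_mul_bounded_linear] lim[rule_format])
    then have t_lim: "t \<longlonglongrightarrow> t\<^sub>0" by (simp add: t\<^sub>0_def matrix_vector_mult_scaleR)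
    have t_eq: "t n = f \<bullet> ((\<gamma> ** ((\<lambda>A. g ** A) ^^ n) \<delta>) *v v) / a ^ n" for n
      by (simp add: t_def matrix_vector_mult_scaleR funpow_matrix_mult_vec divide_inverse mult.commute
          flip: matrix_vector_mul_assoc)
    have tH: "ln \<bar>t n\<bar> \<in> H" if "t n \<noteq> 0" for n
    proof -
      have "ln \<bar>t n\<bar> = ln \<bar>f \<bullet> ((\<gamma> ** ((\<lambda>A. g ** A) ^^ n) \<delta>) *v v)\<bar> - real n * ln \<bar>a\<bar>"
        using that a(2) by (simp add: t_eq abs_divide power_abs ln_div ln_realpow)
      then show ?thesis
        using that shiftH[OF coeffH[OF mul[OF \<gamma>(1) power[OF \<delta>(1)]]]] by (simp add: t_eq)
    qed
    have "ln \<bar>t\<^sub>0\<bar> \<in> H"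
    proof -
      have "ln \<bar>t\<^sub>0\<bar> = ln \<bar>f \<bullet> (\<delta> *v v)\<bar> - (ln 1 - ln \<bar>f \<bullet> (\<gamma> *v v)\<bar>)"
        using \<gamma> \<delta> by (simp add: t\<^sub>0_def abs_mult ln_mult)
      then show ?thesis using coeffH[OF \<gamma>] coeffH[OF \<delta>] diffH by (metis diff_self ln_one)
    qed
    have "(\<lambda>n. ln \<bar>t n\<bar>) \<longlonglongrightarrow> ln \<bar>t\<^sub>0\<bar>"
      by (intro tendsto_ln tendsto_rabs t_lim) (use t0 in simp)
    then have "\<forall>\<^sub>F n in sequentially. dist (ln \<bar>t n\<bar>) (ln \<bar>t\<^sub>0\<bar>) < e" using e by (rule tendstoD)
    moreover have "\<forall>\<^sub>F n in sequentially. dist (t n) t\<^sub>0 < \<bar>t\<^sub>0\<bar>" using t_lim t0 by (intro tendstoD) auto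
    ultimately have "\<forall>\<^sub>F n in sequentially. t n = t\<^sub>0"
    proof eventually_elim
      case (elim n)
      then have "t n \<noteq> 0" by (auto simp: dist_real_def)
      then have "ln \<bar>t n\<bar> - ln \<bar>t\<^sub>0\<bar> = 0"
        using elim tH \<open>ln \<bar>t\<^sub>0\<bar> \<in> H\<close> by (intro discrete diffH) (auto simp: dist_real_def)
      \<comment> \<open>Equal absolute values leave only the sign open, which the second estimate decides.\<close>
      then have "\<bar>t n\<bar> = \<bar>t\<^sub>0\<bar>" using \<open>t n \<noteq> 0\<close> t0 by simp
      then show ?case using elim(2) by (auto simp: dist_real_def abs_if split: if_splits)
    qed
    then obtain N where N: "\<And>n. n \<ge> N \<Longrightarrow> t n = t\<^sub>0" by (auto simp: eventually_sequentially)
    have funpow_v: "((*v) g ^^ n) v = a ^ n *\<^sub>R v" for n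
      by (induction n) (simp_all add: v matrix_vector_mult_scaleR)
    have "(f v* \<gamma>) \<bullet> ((*v) g ^^ n) z = 0" if "n \<ge> N" for n
    proof -
      have z_eq: "((*v) g ^^ n) z = ((*v) g ^^ n) (\<delta> *v v) - (f \<bullet> (\<delta> *v v)) *\<^sub>R a ^ n *\<^sub>R v"
        using funpow_matrix_smult[of n g "f \<bullet> (\<delta> *v v)" v]
        by (simp add: z_def funpow_matrix_diff funpow_v scalar_mult_eq_scaleR)
      have "f \<bullet> (\<gamma> *v ((*v) g ^^ n) (\<delta> *v v)) = a ^ n * t n"
        using a(2) by (simp add: t_def matrix_vector_mult_scaleR field_simps)
      then have "f \<bullet> (\<gamma> *v ((*v) g ^^ n) z) = a ^ n * (t n - t\<^sub>0)"
        unfolding z_eq by (simp add: t\<^sub>0_def matrix_vector_mult_diff_distrib matrix_vector_mult_scaleR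
            inner_diff_right right_diff_distrib)
      then show ?thesis using N[OF that] by (simp add: dot_lmul_matrix)
    qed
    then have "(f v* \<gamma>) \<bullet> z = 0" by (rule functional_vanishes_on_orbit[OF inv[OF g(1)]])
    then show ?thesis by (simp add: dot_lmul_matrix z_def)
  qed
  have ne: "\<Gamma> \<noteq> {}" using g by auto
  note avoid = exists_avoiding_two_hyperplanes[OF assms(2,3) ne]
  have line: "\<delta> *v v = (f \<bullet> (\<delta> *v v)) *\<^sub>R v" if \<delta>: "\<delta> \<in> \<Gamma>" "f \<bullet> (\<delta> *v v) \<noteq> 0" for \<delta>
  proof (rule ccontr)
    assume "\<delta> *v v \<noteq> (f \<bullet> (\<delta> *v v)) *\<^sub>R v"
    then have "\<delta> *v v - (f \<bullet> (\<delta> *v v)) *\<^sub>R v \<noteq> 0" by simp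
    from avoid[OF nz nz(1) this] obtain \<gamma> where "\<gamma> \<in> \<Gamma>" "f \<bullet> (\<gamma> *v v) \<noteq> 0"
      "f \<bullet> (\<gamma> *v (\<delta> *v v - (f \<bullet> (\<delta> *v v)) *\<^sub>R v)) \<noteq> 0" .
    then show False using vanish \<delta> by blast
  qed
  obtain f' where f': "f' \<noteq> 0" "orthogonal v f'"
    using orthogonal_to_vector_exists[of v] assms(1) by auto
  from avoid[OF nz f'(1) nz(2)] obtain \<delta> where \<delta>: "\<delta> \<in> \<Gamma>" "f \<bullet> (\<delta> *v v) \<noteq> 0" "f' \<bullet> (\<delta> *v v) \<noteq> 0" .
  have "f' \<bullet> (\<delta> *v v) = 0"
    using f'(2) by (subst line[OF \<delta>(1,2)]) (simp add: orthogonal_def inner_commute)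
  then show False using \<delta>(3) by simp
qed

end
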